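(* Let $M$ be an oriented, complete Riemannian manifold of dimension at least $1$ equipped with a probability measure $\mu$ induced by a semi-positive top-form. Let $T$ be a real-valued topological invariant of finite simplicial complexes for which there is a function $f:\mathbb{N}\to\mathbb{R}$ such that $|T(S)|\le f(|S|)$ for every finite simplicial complex $S$, where $|S|$ denotes the number of simplices of $S$. Let $n\ge 1$, let $\mathbb{X}=(X_1,\ldots,X_n)$ be $n$ independent samples on $M$, identically distributed according to $\mu$, and for $t\ge 0$ consider the random variable $T(\mathbb{X},t):=T(\operatorname{VR}(\mathbb{X},t))$. Then the function $$t\longmapsto \mathbb{E}[T(\mathbb{X},t)],\qquad t\in[0,\infty),$$ is continuous. If, in addition, there is a constant $K$ such that $|\mu(B_b(p))-\mu(B_a(p))|\le K|b-a|$ for every $p\in M$ and all $a,b\in\mathbb{R}$, then $t\mapsto\mathbb{E}[T(\mathbb{X},t)]$ is Lipschitz continuous.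
   Context: A continuous top-form $\omega$ on an oriented smooth $m$-manifold is called semi-positive if in every oriented coordinate chart it has the form $g\,dx^1\wedge\cdots\wedge dx^m$ with $g\ge 0$. The measure induced by $\omega$ is the Borel measure $\mu(A)=\int_A\omega$; it is a probability measure if $\mu(M)=1$. The product measure on $M^n$ is denoted $\mu^n$, and $\mathbb{X}$ is distributed according to $\mu^n$, so $\mathbb{E}[T(\mathbb{X},t)]=\int_{M^n}T(\mathbb{X},t)\,d\mu^n$. The function $d$ is the Riemannian distance on $M$ (infimum of the lengths of curves joining two points, $+\infty$ if there are none), and $B_r(p)=\{x\in M: d(p,x)<r\}$. The Vietoris-Rips complex $\operatorname{VR}(\mathbb{X},t)$ at scale $t$ is the simplicial complex whose simplices are the nonempty subsets $\sigma\subseteq\{X_1,\ldots,X_n\}$ with $\operatorname{diam}(\sigma)\le t$, where the diameter is taken with respect to $d$. A topological invariant of simplicial complexes is a number that depends only on the homeomorphism type of the complex (for example, the Euler characteristic or the $i$-th Betti number). *)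

theory Defs
  imports "HOL-Probability.Probability"
begin

section \<open>Smooth maps on open sets\<close>

primrec Ck_on :: "nat \<Rightarrow> 'b::real_normed_vector set \<Rightarrow> ('b \<Rightarrow> 'c::real_normed_vector) \<Rightarrow> bool" where
  "Ck_on 0 S f \<longleftrightarrow> continuous_on S f"
| "Ck_on (Suc k) S f \<longleftrightarrow> (\<forall>x\<in>S. f differentiable (at x)) \<and>
     (\<forall>v. Ck_on k S (\<lambda>x. frechet_derivative f (at x) v))"

text \<open>Meant for open \<open>S\<close> only, since derivatives are taken in a full neighbourhood.\<close>

definition smooth_on :: "'b::real_normed_vector set \<Rightarrow> ('b \<Rightarrow> 'c::real_normed_vector) \<Rightarrow> bool" where
  "smooth_on S f \<longleftrightarrow> (\<forall>k. Ck_on k S f)"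

section \<open>Smooth manifolds and orientations\<close>

text \<open>A chart is a pair of a domain and a coordinate map; the values of the map outside the
  domain carry no information. The dimension of the manifold is \<open>CARD('n)\<close>, which is at least 1.\<close>

type_synonym ('a, 'n) chart = "'a set \<times> ('a \<Rightarrow> real ^ 'n)"

definition is_chart :: "'a topology \<Rightarrow> ('a, 'n::finite) chart \<Rightarrow> bool" where
  "is_chart X c \<longleftrightarrow> (case c of (U, \<phi>) \<Rightarrow>
     openin X U \<and> open (\<phi> ` U) \<and>
     homeomorphic_map (subtopology X U) (top_of_set (\<phi> ` U)) \<phi>)"

definition transition :: "('a, 'n::finite) chart \<Rightarrow> ('a, 'n) chart \<Rightarrow> real ^ 'n \<Rightarrow> real ^ 'n" where
  "transition c c' = snd c' \<circ> inv_into (fst c) (snd c)"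

definition overlap :: "('a, 'n::finite) chart \<Rightarrow> ('a, 'n) chart \<Rightarrow> (real ^ 'n) set" where
  "overlap c c' = snd c ` (fst c \<inter> fst c')"

definition transition_deriv ::
    "('a, 'n::finite) chart \<Rightarrow> ('a, 'n) chart \<Rightarrow> real ^ 'n \<Rightarrow> real ^ 'n \<Rightarrow> real ^ 'n" where
  "transition_deriv c c' x = frechet_derivative (transition c c') (at x)"

definition jacobian :: "('a, 'n::finite) chart \<Rightarrow> ('a, 'n) chart \<Rightarrow> real ^ 'n \<Rightarrow> real" where
  "jacobian c c' x = det (matrix (transition_deriv c c' x))"

definition smoothly_compatible :: "('a, 'n::finite) chart \<Rightarrow> ('a, 'n) chart \<Rightarrow> bool" where
  "smoothly_compatible c c' \<longleftrightarrow>
     smooth_on (overlap c c') (transition c c') \<and> smooth_on (overlap c' c) (transition c' c)"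

text \<open>\<open>A\<close> is the maximal smooth atlas.\<close>

definition smooth_manifold :: "'a topology \<Rightarrow> ('a, 'n::finite) chart set \<Rightarrow> bool" where
  "smooth_manifold X A \<longleftrightarrow>
     Hausdorff_space X \<and> second_countable X \<and>
     (\<forall>c\<in>A. is_chart X c) \<and> (\<Union>c\<in>A. fst c) = topspace X \<and>
     (\<forall>c\<in>A. \<forall>c'\<in>A. smoothly_compatible c c') \<and>
     (\<forall>c. is_chart X c \<and> (\<forall>c'\<in>A. smoothly_compatible c c') \<longrightarrow> c \<in> A)"

text \<open>An orientation is given by the set \<open>Ori\<close> of all oriented charts. In positive dimension,
  this is the same as a continuous choice of orientations of the tangent spaces.\<close>

definition orientation :: "'a topology \<Rightarrow> ('a, 'n::finite) chart set \<Rightarrow> ('a, 'n) chart set \<Rightarrow> bool" where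
  "orientation X A Ori \<longleftrightarrow>
     Ori \<subseteq> A \<and> (\<Union>c\<in>Ori. fst c) = topspace X \<and>
     (\<forall>c\<in>Ori. \<forall>c'\<in>Ori. \<forall>x\<in>overlap c c'. jacobian c c' x > 0) \<and>
     (\<forall>c\<in>A. (\<forall>c'\<in>Ori. \<forall>x\<in>overlap c c'. jacobian c c' x > 0) \<longrightarrow> c \<in> Ori)"

section \<open>Riemannian metrics\<close>

text \<open>Tensor fields are given by their coordinate expressions: \<open>G c x u v\<close> is the inner product,
  at the point with coordinates \<open>x\<close> in the chart \<open>c\<close>, of the tangent vectors with components
  \<open>u\<close> and \<open>v\<close> in that chart. The last condition is invariance under change of coordinates.\<close>

type_synonym ('a, 'n) metric_tensor =
  "('a, 'n) chart \<Rightarrow> real ^ 'n \<Rightarrow> real ^ 'n \<Rightarrow> real ^ 'n \<Rightarrow> real"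

definition riemannian_metric ::
    "('a, 'n::finite) chart set \<Rightarrow> ('a, 'n) metric_tensor \<Rightarrow> bool" where
  "riemannian_metric A G \<longleftrightarrow>
     (\<forall>c\<in>A.
        (\<forall>x\<in>snd c ` fst c. bilinear (G c x) \<and> (\<forall>u v. G c x u v = G c x v u) \<and>
           (\<forall>v. v \<noteq> 0 \<longrightarrow> G c x v v > 0)) \<and>
        (\<forall>u v. smooth_on (snd c ` fst c) (\<lambda>x. G c x u v))) \<and>
     (\<forall>c\<in>A. \<forall>c'\<in>A. \<forall>x\<in>overlap c c'. \<forall>u v.
        G c x u v =
        G c' (transition c c' x) (transition_deriv c c' x u) (transition_deriv c c' x v))"

definition C1_curve ::
    "('a, 'n::finite) chart set \<Rightarrow> (real \<Rightarrow> 'a) \<Rightarrow> real \<Rightarrow> real \<Rightarrow> bool" where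
  "C1_curve A \<gamma> a b \<longleftrightarrow>
     (\<forall>(U, \<phi>)\<in>A. \<exists>v.
        (\<forall>s\<in>{a..b} \<inter> \<gamma> -` U. ((\<phi> \<circ> \<gamma>) has_vector_derivative v s) (at s within {a..b})) \<and>
        continuous_on ({a..b} \<inter> \<gamma> -` U) v)"

text \<open>Continuous, and \<open>C\<^sup>1\<close> (one-sided at end points) on every piece of a finite subdivision.\<close>

definition piecewise_C1_curve ::
    "'a topology \<Rightarrow> ('a, 'n::finite) chart set \<Rightarrow> (real \<Rightarrow> 'a) \<Rightarrow> real \<Rightarrow> real \<Rightarrow> bool" where
  "piecewise_C1_curve X A \<gamma> a b \<longleftrightarrow>
     a \<le> b \<and> continuous_map (top_of_set {a..b}) X \<gamma> \<and>
     (\<exists>S. finite S \<and>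
        (\<forall>p q. a \<le> p \<and> p < q \<and> q \<le> b \<and> {p<..<q} \<inter> S = {} \<longrightarrow> C1_curve A \<gamma> p q))"

text \<open>By invariance of the metric, the speed does not depend on the chart that is chosen. It is
  only meaningful away from the finitely many break points, which do not affect the length.\<close>

definition curve_speed ::
    "('a, 'n::finite) chart set \<Rightarrow> ('a, 'n) metric_tensor \<Rightarrow> (real \<Rightarrow> 'a) \<Rightarrow> real \<Rightarrow> real" where
  "curve_speed A G \<gamma> t =
     (let c = (SOME c. c \<in> A \<and> \<gamma> t \<in> fst c);
          v = vector_derivative (snd c \<circ> \<gamma>) (at t)
      in sqrt (G c (snd c (\<gamma> t)) v v))"

definition curve_length ::
    "('a, 'n::finite) chart set \<Rightarrow> ('a, 'n) metric_tensor \<Rightarrow> (real \<Rightarrow> 'a) \<Rightarrow> real \<Rightarrow> real \<Rightarrow> ennreal" where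
  "curve_length A G \<gamma> a b = (\<integral>\<^sup>+t\<in>{a..b}. ennreal (curve_speed A G \<gamma> t) \<partial>lborel)"

text \<open>The infimum of the empty set is \<open>\<infinity>\<close> in \<^typ>\<open>ennreal\<close>.\<close>

definition riemannian_distance ::
    "'a topology \<Rightarrow> ('a, 'n::finite) chart set \<Rightarrow> ('a, 'n) metric_tensor \<Rightarrow> 'a \<Rightarrow> 'a \<Rightarrow> ennreal" where
  "riemannian_distance X A G p q =
     Inf {curve_length A G \<gamma> a b | \<gamma> a b. piecewise_C1_curve X A \<gamma> a b \<and> \<gamma> a = p \<and> \<gamma> b = q}"

definition riemannian_ball ::
    "'a topology \<Rightarrow> ('a, 'n::finite) chart set \<Rightarrow> ('a, 'n) metric_tensor \<Rightarrow> real \<Rightarrow> 'a \<Rightarrow> 'a set" where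
  "riemannian_ball X A G r p = {x \<in> topspace X. riemannian_distance X A G p x < ennreal r}"

text \<open>Completeness in the sense of Cauchy sequences.\<close>

definition riemannian_complete ::
    "'a topology \<Rightarrow> ('a, 'n::finite) chart set \<Rightarrow> ('a, 'n) metric_tensor \<Rightarrow> bool" where
  "riemannian_complete X A G \<longleftrightarrow>
     (\<forall>s::nat \<Rightarrow> 'a. range s \<subseteq> topspace X \<longrightarrow>
        (\<forall>e>0. \<exists>N. \<forall>i\<ge>N. \<forall>j\<ge>N. riemannian_distance X A G (s i) (s j) < e) \<longrightarrow>
        (\<exists>p\<in>topspace X. (\<lambda>i. riemannian_distance X A G (s i) p) \<longlonglongrightarrow> 0))"

section \<open>Top-forms and the measures they induce\<close>

text \<open>\<open>w c\<close> is the function \<open>g\<close> in the expression \<open>g dx\<^sup>1 \<and> \<dots> \<and> dx\<^sup>m\<close> of the form in the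
  chart \<open>c\<close>; the last condition is the transformation law of top-forms.\<close>

type_synonym ('a, 'n) top_form = "('a, 'n) chart \<Rightarrow> real ^ 'n \<Rightarrow> real"

definition continuous_top_form ::
    "('a, 'n::finite) chart set \<Rightarrow> ('a, 'n) top_form \<Rightarrow> bool" where
  "continuous_top_form A w \<longleftrightarrow>
     (\<forall>c\<in>A. continuous_on (snd c ` fst c) (w c)) \<and>
     (\<forall>c\<in>A. \<forall>c'\<in>A. \<forall>x\<in>overlap c c'. w c x = w c' (transition c c' x) * jacobian c c' x)"

definition semi_positive ::
    "('a, 'n::finite) chart set \<Rightarrow> ('a, 'n) top_form \<Rightarrow> bool" where
  "semi_positive Ori w \<longleftrightarrow> (\<forall>c\<in>Ori. \<forall>x\<in>snd c ` fst c. w c x \<ge> 0)"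

definition borel_sets :: "'a topology \<Rightarrow> 'a set set" where
  "borel_sets X = sigma_sets (topspace X) {U. openin X U}"

text \<open>\<open>has_form_integral X Ori w E I\<close> means that the integral of the semi-positive form \<open>w\<close> over the
  Borel set \<open>E\<close> is \<open>I\<close>: cut \<open>E\<close> into countably many disjoint Borel pieces, each inside an oriented
  chart, integrate there in coordinates, and add up. By the change of variables formula,
  \<open>I\<close> does not depend on the pieces and charts.\<close>

definition has_form_integral ::
    "'a topology \<Rightarrow> ('a, 'n::finite) chart set \<Rightarrow> ('a, 'n) top_form \<Rightarrow> 'a set \<Rightarrow> ennreal \<Rightarrow> bool" where
  "has_form_integral X Ori w E I \<longleftrightarrow>
     (\<exists>(c :: nat \<Rightarrow> ('a, 'n) chart) (B :: nat \<Rightarrow> 'a set).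
        (\<forall>i. c i \<in> Ori \<and> B i \<in> borel_sets X \<and> B i \<subseteq> fst (c i)) \<and>
        disjoint_family B \<and> (\<Union>i. B i) = E \<and>
        I = (\<Sum>i. \<integral>\<^sup>+x\<in>snd (c i) ` B i. ennreal (w (c i) x) \<partial>lborel))"

definition induced_measure ::
    "'a topology \<Rightarrow> ('a, 'n::finite) chart set \<Rightarrow> ('a, 'n) top_form \<Rightarrow> 'a measure \<Rightarrow> bool" where
  "induced_measure X Ori w \<mu> \<longleftrightarrow>
     space \<mu> = topspace X \<and> sets \<mu> = borel_sets X \<and>
     (\<forall>E\<in>borel_sets X. has_form_integral X Ori w E (emeasure \<mu> E))"

section \<open>Simplicial complexes\<close>

text \<open>Abstract complexes, as sets of nonempty simplices.\<close>

definition finite_simplicial_complex :: "'v set set \<Rightarrow> bool" where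
  "finite_simplicial_complex K \<longleftrightarrow>
     finite K \<and> (\<forall>\<sigma>\<in>K. finite \<sigma> \<and> \<sigma> \<noteq> {} \<and> (\<forall>\<tau>. \<tau> \<subseteq> \<sigma> \<and> \<tau> \<noteq> {} \<longrightarrow> \<tau> \<in> K))"

text \<open>Barycentric coordinates, with the topology of pointwise convergence, which is the usual one
  for finite complexes.\<close>

definition geometric_realization :: "'v set set \<Rightarrow> ('v \<Rightarrow> real) topology" where
  "geometric_realization K = subtopology (powertop_real UNIV)
     {\<alpha>. (\<forall>v. \<alpha> v \<ge> 0) \<and> {v. \<alpha> v \<noteq> 0} \<in> K \<and> (\<Sum>v | \<alpha> v \<noteq> 0. \<alpha> v) = 1}"

definition topological_invariant :: "('v set set \<Rightarrow> real) \<Rightarrow> bool" where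
  "topological_invariant T \<longleftrightarrow>
     (\<forall>K L. finite_simplicial_complex K \<longrightarrow> finite_simplicial_complex L \<longrightarrow>
        geometric_realization K homeomorphic_space geometric_realization L \<longrightarrow> T K = T L)"

definition diam :: "('v \<Rightarrow> 'v \<Rightarrow> ennreal) \<Rightarrow> 'v set \<Rightarrow> ennreal" where
  "diam d \<sigma> = (SUP x\<in>\<sigma>. SUP y\<in>\<sigma>. d x y)"

definition vietoris_rips :: "('v \<Rightarrow> 'v \<Rightarrow> ennreal) \<Rightarrow> 'v set \<Rightarrow> real \<Rightarrow> 'v set set" where
  "vietoris_rips d P t = {\<sigma>. \<sigma> \<subseteq> P \<and> \<sigma> \<noteq> {} \<and> diam d \<sigma> \<le> ennreal t}"

end

theory Submission
  imports Defs
begin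

text \<open>
  As the scale grows from \<open>s\<close> to \<open>t\<close>, the Vietoris-Rips complex of a fixed sample changes only if
  the distance of some pair of sample points lies in \<open>(s, t]\<close>. The invariant is bounded by a
  constant on all complexes with at most \<open>2 ^ n\<close> simplices, so everything follows from estimates of
  the measure of spherical shells around a point. The crucial fact is that every Riemannian sphere
  \<open>{q. d(p, q) = t}\<close> is a null set for \<open>\<mu>\<close> (\<open>sphere_null\<close>). By Fubini, almost no sample then has
  two points of different indices at distance exactly \<open>t\<close>, so that the complexes at scales \<open>s \<longlonglongrightarrow> t\<close> eventually agree
  with the one at scale \<open>t\<close>, and dominated convergence gives continuity. If balls grow at most
  linearly in measure, so do shells, because the boundary spheres are null; summing over all
  pairs of indices bounds the increment of the expectation.

  Spheres are null because they are porous in coordinates (\<open>negligible_chart_sphere\<close>). Let \<open>q\<close> be at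
  distance \<open>t\<close> from \<open>p\<close> and take a curve from \<open>p\<close> to \<open>q\<close> of length hardly more than \<open>t\<close>. In a chart
  where the metric is comparable with the Euclidean one, the last piece of that curve, from the point
  \<open>w\<close> where it enters the coordinate ball of radius \<open>R\<close> around \<open>q\<close>, has length at least \<open>\<kappa> R\<close>.
  So \<open>w\<close> is nearer to \<open>p\<close> than \<open>t\<close> by a fixed multiple of \<open>R\<close>, and straight coordinate segments
  show the same for all points in a ball around \<open>w\<close> of radius proportional to \<open>R\<close>. At every small scale,
  the sphere thus misses a fixed proportion of the ball around \<open>q\<close>, which by the Vitali
  covering theorem is impossible for a set of positive measure (\<open>porous_imp_negligible\<close>).

  Measurability of the random variable has two sources. The distance is upper semicontinuous on the
  product space (\<open>openin_distance_less\<close>), so it is measurable for the product \<open>\<sigma>\<close>-algebra because the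
  manifold is second countable; similarly, the diagonal is measurable because the manifold is Hausdorff.
  Moreover, the value of a topological invariant depends only on which sample points coincide
  and which pairs are within distance \<open>t\<close>, since samples with the same such pattern have isomorphic
  complexes (\<open>invariant_vietoris_rips_sample_pattern\<close>), and there are only finitely many patterns.
\<close>

section \<open>Porous sets are negligible\<close>

text \<open>
  Every hole occupies the proportion \<open>c ^ DIM('a)\<close> of the ball that contains it. Disjoint small balls
  around points of \<open>S\<close> inside an open set of almost the same measure cover almost all of \<open>S\<close>, by
  Vitali; removing the holes from them removes a fixed proportion of the measure without
  losing any point of \<open>S\<close>, which is too much if \<open>S\<close> has positive measure.
\<close>
lemma porous_lmeasurable_imp_negligible:
  fixes S :: "'a::euclidean_space set"
  assumes S: "S \<in> lmeasurable" and c: "0 < c"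
    and por: "\<And>x. x \<in> S \<Longrightarrow> \<exists>r0>0. \<forall>r. 0 < r \<and> r < r0 \<longrightarrow>
                (\<exists>y. ball y (c * r) \<subseteq> ball x r \<and> ball y (c * r) \<inter> S = {})"
  shows "negligible S"
proof (rule ccontr)
  assume "\<not> negligible S"
  then have m: "measure lebesgue S > 0"
    using S by (simp add: negligible_iff_measure0 zero_less_measure_iff)
  define \<theta> where "\<theta> = c ^ DIM('a)"
  have \<theta>: "\<theta> > 0" using c by (simp add: \<theta>_def)
  \<comment> \<open>The excess \<open>\<theta> m\<close> over the measure \<open>m\<close> of \<open>S\<close> leads to \<open>m \<le> (1 - \<theta>) (1 + \<theta>) m\<close> at the end.\<close>
  obtain U where U: "open U" "S \<subseteq> U" "U - S \<in> lmeasurable"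
      "emeasure lebesgue (U - S) < ennreal (\<theta> * measure lebesgue S)"
    using sets_lebesgue_outer_open[OF fmeasurableD[OF S] mult_pos_pos[OF \<theta> m]] .
  define K where "K = {(x, r). 0 < r \<and> ball x r \<subseteq> U \<and>
      (\<exists>y. ball y (c * r) \<subseteq> ball x r \<and> ball y (c * r) \<inter> S = {})}"
  have fine: "\<exists>i. i \<in> K \<and> x \<in> ball (fst i) (snd i) \<and> snd i < e" if "x \<in> S" "0 < e" for x e
  proof -
    obtain r0 where r0: "r0 > 0" "\<And>r. 0 < r \<and> r < r0 \<Longrightarrow>
        \<exists>y. ball y (c * r) \<subseteq> ball x r \<and> ball y (c * r) \<inter> S = {}"
      using por[OF \<open>x \<in> S\<close>] by auto
    obtain k where k: "k > 0" "ball x k \<subseteq> U"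
      using U \<open>x \<in> S\<close> by (meson open_contains_ball subsetD)
    define r where "r = min (min r0 k) e / 2"
    have r: "0 < r" "r < r0" "r < k" "r < e" using r0 k \<open>0 < e\<close> by (auto simp: r_def)
    have "ball x r \<subseteq> U" using k r by (meson less_imp_le order_trans subset_ball)
    then have "(x, r) \<in> K" using r r0(2)[of r] by (auto simp: K_def)
    then show ?thesis using r by (intro exI[of _ "(x, r)"]) auto
  qed
  obtain C where C: "countable C" "C \<subseteq> K"
     "pairwise (\<lambda>i j. disjnt (ball (fst i) (snd i)) (ball (fst j) (snd j))) C"
     "negligible (S - (\<Union>i \<in> C. ball (fst i) (snd i)))"
    using Vitali_covering_theorem_balls[of S K fst snd, OF fine] by blast
  have "\<forall>i\<in>K. \<exists>y. ball y (c * snd i) \<subseteq> ball (fst i) (snd i) \<and> ball y (c * snd i) \<inter> S = {}"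
    by (auto simp: K_def)
  from bchoice[OF this] obtain y where y: "\<forall>i\<in>K. ball (y i) (c * snd i) \<subseteq> ball (fst i) (snd i) \<and>
      ball (y i) (c * snd i) \<inter> S = {}" ..
  have KU: "ball (fst i) (snd i) \<subseteq> U" "0 < snd i" if "i \<in> K" for i
    using that by (auto simp: K_def)
  define V where "V = (\<Union>i\<in>C. ball (fst i) (snd i))"
  define W where "W = (\<Union>i\<in>C. ball (y i) (c * snd i))"
  have WV: "W \<subseteq> V" unfolding V_def W_def using y C(2) by (intro UN_mono) blast+
  have VU: "V \<subseteq> U" unfolding V_def by (rule UN_least) (use C(2) KU in blast)
  have Um: "emeasure lebesgue U = emeasure lebesgue S + emeasure lebesgue (U - S)"
    using plus_emeasure[of S lebesgue "U - S"] S U by (simp add: fmeasurableD Un_absorb1)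
  also have "\<dots> < emeasure lebesgue S + ennreal (\<theta> * measure lebesgue S)"
    using U(4) S by (intro ennreal_add_left_cancel_less[THEN iffD2]) (auto simp: fmeasurable_def)
  also have "\<dots> = ennreal (measure lebesgue S + \<theta> * measure lebesgue S)"
    using S m \<theta> by (simp add: emeasure_eq_measure2 ennreal_plus)
  finally have Uless: "emeasure lebesgue U < ennreal (measure lebesgue S + \<theta> * measure lebesgue S)" .
  have sets: "open V" "open W" by (auto simp: V_def W_def)
  then have [simp]: "V \<in> sets lebesgue" "W \<in> sets lebesgue" by auto
  have disjV: "disjoint_family_on (\<lambda>i. ball (fst i) (snd i)) C"
    using C(3) unfolding disjoint_family_on_def pairwise_def disjnt_def by blast
  have disjW: "disjoint_family_on (\<lambda>i. ball (y i) (c * snd i)) C"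
    unfolding disjoint_family_on_def
  proof (intro ballI impI)
    fix i j assume ij: "i \<in> C" "j \<in> C" "i \<noteq> j"
    then have "ball (fst i) (snd i) \<inter> ball (fst j) (snd j) = {}"
      using disjV by (auto simp: disjoint_family_on_def)
    moreover have "ball (y i) (c * snd i) \<subseteq> ball (fst i) (snd i)"
      "ball (y j) (c * snd j) \<subseteq> ball (fst j) (snd j)" using ij y C(2) by blast+
    ultimately show "ball (y i) (c * snd i) \<inter> ball (y j) (c * snd j) = {}" by blast
  qed
  have scale: "emeasure lebesgue (ball (y i) (c * snd i)) =
      ennreal \<theta> * emeasure lebesgue (ball (fst i) (snd i))" if "i \<in> C" for i
  proof -
    have "0 < snd i" using that C(2) KU by blast
    then show ?thesis using c
      by (simp add: emeasure_ball \<theta>_def power_mult_distrib flip: ennreal_mult)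
  qed
  have "emeasure lebesgue W = (\<integral>\<^sup>+i. emeasure lebesgue (ball (y i) (c * snd i)) \<partial>count_space C)"
    unfolding W_def using C(1) disjW by (intro emeasure_UN_countable) auto
  also have "\<dots> = (\<integral>\<^sup>+i. ennreal \<theta> * emeasure lebesgue (ball (fst i) (snd i)) \<partial>count_space C)"
    using scale by (intro nn_integral_cong) auto
  also have "\<dots> = ennreal \<theta> * (\<integral>\<^sup>+i. emeasure lebesgue (ball (fst i) (snd i)) \<partial>count_space C)"
    by (intro nn_integral_cmult) auto
  also have "(\<integral>\<^sup>+i. emeasure lebesgue (ball (fst i) (snd i)) \<partial>count_space C) = emeasure lebesgue V"
    unfolding V_def using C(1) disjV by (intro emeasure_UN_countable[symmetric]) auto
  finally have WV': "emeasure lebesgue W = ennreal \<theta> * emeasure lebesgue V" .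
  have "emeasure lebesgue V \<le> emeasure lebesgue U" using VU U(1) by (intro emeasure_mono) auto
  then have Vless: "emeasure lebesgue V < ennreal (measure lebesgue S + \<theta> * measure lebesgue S)"
    using Uless by simp
  then have Vfin: "V \<in> lmeasurable"
    by (metis fmeasurableI \<open>V \<in> sets lebesgue\<close> ennreal_less_top infinity_ennreal_def order.strict_trans)
  then have Wfin: "W \<in> lmeasurable" using WV fmeasurableI2 \<open>W \<in> sets lebesgue\<close> by blast
  have mV: "measure lebesgue V < measure lebesgue S + \<theta> * measure lebesgue S"
    using Vless Vfin m \<theta> by (simp add: emeasure_eq_measure2 ennreal_less_iff del: ennreal_plus)
  have mW: "measure lebesgue W = \<theta> * measure lebesgue V"
    using WV' \<theta> by (simp add: measure_def enn2real_mult)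
  have "measure lebesgue S \<le> measure lebesgue (V - W)"
  proof -
    have "S \<subseteq> (V - W) \<union> (S - V)" using y C(2) unfolding W_def by blast
    moreover have "measure lebesgue ((V - W) \<union> (S - V)) = measure lebesgue (V - W)"
      using C(4) Vfin Wfin
      by (intro measure_Un_null_set) (auto simp: V_def[symmetric] negligible_iff_null_sets)
    moreover have "(V - W) \<union> (S - V) \<in> lmeasurable"
      using Vfin Wfin S by (intro fmeasurable.Un fmeasurable.Diff) auto
    ultimately show ?thesis using S by (metis fmeasurableD measure_mono_fmeasurable)
  qed
  also have "\<dots> = measure lebesgue V - \<theta> * measure lebesgue V"
    using measurable_measure_Diff[OF Vfin _ WV] mW by simp
  finally have "measure lebesgue S \<le> (1 - \<theta>) * measure lebesgue V" by (simp add: algebra_simps)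
  moreover have "\<theta> \<le> 1"
  proof (rule ccontr)
    assume "\<not> \<theta> \<le> 1"
    then have "(1 - \<theta>) * measure lebesgue V \<le> 0" by (intro mult_nonpos_nonneg) auto
    then show False using calculation m by linarith
  qed
  ultimately have "measure lebesgue S \<le> (1 - \<theta>) * (measure lebesgue S + \<theta> * measure lebesgue S)"
    using mult_left_mono[of "measure lebesgue V" "measure lebesgue S + \<theta> * measure lebesgue S" "1 - \<theta>"] mV
    by linarith
  also have "\<dots> = measure lebesgue S - \<theta>\<^sup>2 * measure lebesgue S"
    by (simp add: algebra_simps power2_eq_square)
  finally show False using mult_pos_pos[OF zero_less_power[OF \<theta>, of 2] m] by linarith
qed

lemma porous_imp_negligible:
  fixes S :: "'a::euclidean_space set"
  assumes S: "S \<in> sets lebesgue" and c: "0 < c"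
    and por: "\<And>x. x \<in> S \<Longrightarrow> \<exists>r0>0. \<forall>r. 0 < r \<and> r < r0 \<longrightarrow>
                (\<exists>y. ball y (c * r) \<subseteq> ball x r \<and> ball y (c * r) \<inter> S = {})"
  shows "negligible S"
proof -
  have "negligible (S \<inter> ball 0 (real k))" for k
  proof (rule porous_lmeasurable_imp_negligible[OF _ c])
    show "S \<inter> ball 0 (real k) \<in> lmeasurable"
      using fmeasurable_Int_fmeasurable[OF lmeasurable_ball S, of 0 "real k"] by (simp add: Int_commute)
  next
    fix x assume "x \<in> S \<inter> ball 0 (real k)"
    then obtain r0 where "r0 > 0" and r0: "\<forall>r. 0 < r \<and> r < r0 \<longrightarrow>
        (\<exists>y. ball y (c * r) \<subseteq> ball x r \<and> ball y (c * r) \<inter> S = {})"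
      using por by blast
    have "\<exists>y. ball y (c * r) \<subseteq> ball x r \<and> ball y (c * r) \<inter> (S \<inter> ball 0 (real k)) = {}"
      if r: "0 < r \<and> r < r0" for r
    proof -
      obtain y where "ball y (c * r) \<subseteq> ball x r" "ball y (c * r) \<inter> S = {}" using r0 r by blast
      then show ?thesis by (intro exI[of _ y]) auto
    qed
    then show "\<exists>r0>0. \<forall>r. 0 < r \<and> r < r0 \<longrightarrow>
        (\<exists>y. ball y (c * r) \<subseteq> ball x r \<and> ball y (c * r) \<inter> (S \<inter> ball 0 (real k)) = {})"
      using \<open>r0 > 0\<close> by blast
  qed
  then have "negligible (\<Union>k. S \<inter> ball 0 (real k))"
    by (intro negligible_countable_Union) auto
  moreover have "S \<subseteq> (\<Union>k. S \<inter> ball 0 (real k))"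
  proof
    fix x assume "x \<in> S"
    obtain k where "norm x < real k" using reals_Archimedean2 by blast
    then show "x \<in> (\<Union>k. S \<inter> ball 0 (real k))" using \<open>x \<in> S\<close> by auto
  qed
  ultimately show ?thesis by (rule negligible_subset)
qed

section \<open>Charts and the Riemannian metric\<close>

text \<open>
  Only meaningful on the image of the chart.
\<close>
definition chart_inv :: "('a, 'n::finite) chart \<Rightarrow> real ^ 'n \<Rightarrow> 'a" where
  "chart_inv c = inv_into (fst c) (snd c)"

locale riemannian_structure =
  fixes X :: "'a topology" and A :: "('a, 'n::finite) chart set" and G :: "('a, 'n) metric_tensor"
  assumes manifold: "smooth_manifold X A" and metric: "riemannian_metric A G"
begin

lemma atlas:
  shows Hausdorff: "Hausdorff_space X" and second_countable: "second_countable X"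
    and is_chart: "c \<in> A \<Longrightarrow> is_chart X c"
    and Union_charts: "(\<Union>c\<in>A. fst c) = topspace X"
    and compatible: "c \<in> A \<Longrightarrow> c' \<in> A \<Longrightarrow> smoothly_compatible c c'"
  using manifold unfolding smooth_manifold_def by blast+

lemma ex_chart: "q \<in> topspace X \<Longrightarrow> \<exists>c\<in>A. q \<in> fst c"
  using Union_charts by blast

lemma chart_homeomorphism:
  assumes "c \<in> A"
  shows "openin X (fst c)" "fst c \<subseteq> topspace X" "open (snd c ` fst c)" "inj_on (snd c) (fst c)"
    "continuous_map (subtopology X (fst c)) euclidean (snd c)"
    "continuous_map (top_of_set (snd c ` fst c)) X (chart_inv c)"
proof -
  have op: "openin X (fst c)" and im: "open (snd c ` fst c)"
    and hom: "homeomorphic_map (subtopology X (fst c)) (top_of_set (snd c ` fst c)) (snd c)"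
    using is_chart[OF assms] by (auto simp: is_chart_def split: prod.splits)
  then show "openin X (fst c)" "open (snd c ` fst c)" "fst c \<subseteq> topspace X"
    by (auto dest: openin_subset)
  then have top: "topspace (subtopology X (fst c)) = fst c" by auto
  show inj: "inj_on (snd c) (fst c)"
    using hom top by (simp add: homeomorphic_map_def)
  show "continuous_map (subtopology X (fst c)) euclidean (snd c)"
    using hom homeomorphic_imp_continuous_map continuous_map_into_fulltopology by blast
  obtain g where g: "homeomorphic_maps (subtopology X (fst c)) (top_of_set (snd c ` fst c)) (snd c) g"
    using hom by (auto simp: homeomorphic_map_maps)
  have "continuous_map (top_of_set (snd c ` fst c)) X g"
    using g continuous_map_into_fulltopology by (auto simp: homeomorphic_maps_def)
  moreover have "g u = chart_inv c u" if "u \<in> snd c ` fst c" for u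
    using g that inj top by (auto simp: homeomorphic_maps_def chart_inv_def inv_into_f_f)
  ultimately show "continuous_map (top_of_set (snd c ` fst c)) X (chart_inv c)"
    by (rule continuous_map_eq) auto
qed

lemma chart_inv_inverse:
  assumes "c \<in> A"
  shows "q \<in> fst c \<Longrightarrow> chart_inv c (snd c q) = q"
    "u \<in> snd c ` fst c \<Longrightarrow> snd c (chart_inv c u) = u"
    "u \<in> snd c ` fst c \<Longrightarrow> chart_inv c u \<in> fst c"
  using chart_homeomorphism(4)[OF assms] by (auto simp: chart_inv_def inv_into_into f_inv_into_f)

lemma openin_chart_preimage:
  assumes "c \<in> A" "open W"
  shows "openin X {q \<in> fst c. snd c q \<in> W}"
proof -
  have "openin (subtopology X (fst c)) {q \<in> topspace (subtopology X (fst c)). snd c q \<in> W}"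
    by (rule openin_continuous_map_preimage[OF chart_homeomorphism(5)[OF assms(1)]])
      (use assms(2) in \<open>simp flip: open_openin\<close>)
  moreover have "topspace (subtopology X (fst c)) = fst c"
    using chart_homeomorphism(2)[OF assms(1)] by auto
  ultimately have "openin (subtopology X (fst c)) {q \<in> fst c. snd c q \<in> W}"
    by (simp only:)
  then show ?thesis
    using openin_open_subtopology[OF chart_homeomorphism(1)[OF assms(1)]] by blast
qed

lemma open_chart_image:
  assumes "c \<in> A" "openin X V"
  shows "open {u \<in> snd c ` fst c. chart_inv c u \<in> V}"
proof -
  have "openin (top_of_set (snd c ` fst c)) {u \<in> topspace (top_of_set (snd c ` fst c)). chart_inv c u \<in> V}"
    using chart_homeomorphism(6)[OF assms(1)] assms(2) by (rule openin_continuous_map_preimage)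
  then show ?thesis using chart_homeomorphism(3)[OF assms(1)] by (simp add: openin_open_eq)
qed

lemma overlapI: "q \<in> fst c \<Longrightarrow> q \<in> fst c' \<Longrightarrow> snd c q \<in> overlap c c'"
  by (auto simp: overlap_def)

lemma transition_conv: "transition c c' = snd c' \<circ> chart_inv c"
  by (simp add: transition_def chart_inv_def)

lemma transition_C1:
  assumes "c \<in> A" "c' \<in> A"
  shows "x \<in> overlap c c' \<Longrightarrow> (transition c c' has_derivative transition_deriv c c' x) (at x)"
    "continuous_on (overlap c c') (\<lambda>x. transition_deriv c c' x v)"
proof -
  have "smooth_on (overlap c c') (transition c c')"
    using compatible[OF assms] by (simp add: smoothly_compatible_def)
  then have C1: "Ck_on (Suc 0) (overlap c c') (transition c c')" unfolding smooth_on_def by blast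
  show "(transition c c' has_derivative transition_deriv c c' x) (at x)" if "x \<in> overlap c c'"
    using C1 that by (auto simp: transition_deriv_def frechet_derivative_works)
  show "continuous_on (overlap c c') (\<lambda>x. transition_deriv c c' x v)"
    using C1 by (simp add: transition_deriv_def)
qed

lemma metric_facts:
  assumes "c \<in> A"
  shows "x \<in> snd c ` fst c \<Longrightarrow> bilinear (G c x)"
    "x \<in> snd c ` fst c \<Longrightarrow> v \<noteq> 0 \<Longrightarrow> G c x v v > 0"
    "continuous_on (snd c ` fst c) (\<lambda>x. G c x u v)"
proof -
  have "(\<forall>x\<in>snd c ` fst c. bilinear (G c x) \<and> (\<forall>u v. G c x u v = G c x v u) \<and>
           (\<forall>v. v \<noteq> 0 \<longrightarrow> G c x v v > 0)) \<and>
        (\<forall>u v. smooth_on (snd c ` fst c) (\<lambda>x. G c x u v))"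
    using metric assms unfolding riemannian_metric_def by blast
  then show "x \<in> snd c ` fst c \<Longrightarrow> bilinear (G c x)"
    "x \<in> snd c ` fst c \<Longrightarrow> v \<noteq> 0 \<Longrightarrow> G c x v v > 0"
    and "continuous_on (snd c ` fst c) (\<lambda>x. G c x u v)"
    unfolding smooth_on_def by (blast, blast, metis Ck_on.simps(1))
qed

lemma metric_transition:
  assumes "c \<in> A" "c' \<in> A" "x \<in> overlap c c'"
  shows "G c x u v = G c' (transition c c' x) (transition_deriv c c' x u) (transition_deriv c c' x v)"
  using metric assms unfolding riemannian_metric_def by blast

lemma metric_scale:
  assumes "c \<in> A" "x \<in> snd c ` fst c"
  shows "G c x (r *\<^sub>R v) (r *\<^sub>R v) = r\<^sup>2 * G c x v v"
  using metric_facts(1)[OF assms]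
  by (simp add: bilinear_lmul bilinear_rmul power2_eq_square)

text \<open>
  Smoothness of a metric is given for fixed vectors only; expanding in a basis gives joint continuity.
\<close>
lemma continuous_on_metric:
  assumes "c \<in> A"
  shows "continuous_on (snd c ` fst c \<times> UNIV) (\<lambda>(x, v). G c x v v)"
proof -
  have "G c x v v = (\<Sum>i\<in>Basis. \<Sum>j\<in>Basis. (v \<bullet> i) * (v \<bullet> j) * G c x i j)"
    if "x \<in> snd c ` fst c" for x v
  proof -
    have bl: "linear (\<lambda>u. G c x u w)" "linear (G c x u)" for u w
      using metric_facts(1)[OF assms that] by (auto simp: bilinear_def)
    have "G c x v v = G c x (\<Sum>i\<in>Basis. (v \<bullet> i) *\<^sub>R i) v" by (simp add: euclidean_representation)
    also have "\<dots> = (\<Sum>i\<in>Basis. (v \<bullet> i) * G c x i v)"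
      by (simp add: linear_sum[OF bl(1)] linear_cmul[OF bl(1)])
    also have "\<dots> = (\<Sum>i\<in>Basis. (v \<bullet> i) * G c x i (\<Sum>j\<in>Basis. (v \<bullet> j) *\<^sub>R j))"
      by (simp add: euclidean_representation)
    also have "\<dots> = (\<Sum>i\<in>Basis. \<Sum>j\<in>Basis. (v \<bullet> i) * (v \<bullet> j) * G c x i j)"
      by (simp add: linear_sum[OF bl(2)] linear_cmul[OF bl(2)] sum_distrib_left mult.assoc)
    finally show ?thesis .
  qed
  then have eq: "(case z of (x, v) \<Rightarrow> G c x v v) =
      (\<Sum>i\<in>Basis. \<Sum>j\<in>Basis. (snd z \<bullet> i) * (snd z \<bullet> j) * G c (fst z) i j)"
    if "z \<in> snd c ` fst c \<times> UNIV" for z using that by (cases z) auto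
  have "continuous_on (snd c ` fst c \<times> UNIV) (\<lambda>z. G c (fst z) i j)" for i j
    by (rule continuous_on_compose2[OF metric_facts(3)[OF assms]]) (auto intro: continuous_intros)
  then have "continuous_on (snd c ` fst c \<times> UNIV)
      (\<lambda>z. \<Sum>i\<in>Basis. \<Sum>j\<in>Basis. (snd z \<bullet> i) * (snd z \<bullet> j) * G c (fst z) i j)"
    by (intro continuous_intros)
  then show ?thesis by (rule continuous_on_eq) (simp only: eq)
qed

text \<open>
  The quadratic form is continuous and positive on the compact product of \<open>K\<close> with the unit sphere,
  so it has positive bounds there, which extend to all vectors by homogeneity.
\<close>
lemma metric_bounds_on_compact:
  assumes "c \<in> A" "compact K" "K \<subseteq> snd c ` fst c"
  obtains \<kappa> C where "0 < \<kappa>" "0 < C"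
    "\<And>x v. x \<in> K \<Longrightarrow> \<kappa> * norm v \<le> sqrt (G c x v v) \<and> sqrt (G c x v v) \<le> C * norm v"
proof (cases "K = {}")
  case False
  let ?N = "\<lambda>(x, v). sqrt (G c x v v)"
  let ?S = "K \<times> sphere (0::real^'n) 1"
  have cpt: "compact ?S" using assms(2) by (intro compact_Times) auto
  have ne: "?S \<noteq> {}" using False by auto
  have cont: "continuous_on ?S ?N"
    using continuous_on_subset[OF continuous_on_metric[OF assms(1)], of ?S] assms(3)
    by (auto simp: case_prod_unfold intro!: continuous_on_real_sqrt)
  obtain z1 where z1: "z1 \<in> ?S" "\<And>z. z \<in> ?S \<Longrightarrow> ?N z1 \<le> ?N z"
    using continuous_attains_inf[OF cpt ne cont] by auto
  obtain z2 where z2: "z2 \<in> ?S" "\<And>z. z \<in> ?S \<Longrightarrow> ?N z \<le> ?N z2"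
    using continuous_attains_sup[OF cpt ne cont] by auto
  have pos: "?N z > 0" if "z \<in> ?S" for z
  proof -
    obtain x v where z: "z = (x, v)" by (cases z)
    have "v \<noteq> 0" "x \<in> snd c ` fst c" using that assms(3) by (auto simp: z)
    then show ?thesis using metric_facts(2)[OF assms(1)] by (simp add: z)
  qed
  show ?thesis
  proof (rule that[of "?N z1" "?N z2"])
    show "?N z1 > 0" "?N z2 > 0" using pos z1(1) z2(1) by blast+
    fix x v assume x: "x \<in> K"
    show "?N z1 * norm v \<le> sqrt (G c x v v) \<and> sqrt (G c x v v) \<le> ?N z2 * norm v"
    proof (cases "v = 0")
      case True
      have "G c x 0 0 = 0"
        using bilinear_lzero[OF metric_facts(1)[OF assms(1)]] x assms(3) by blast
      then show ?thesis using True by simp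
    next
      case False
      define u where "u = v /\<^sub>R norm v"
      have u: "(x, u) \<in> ?S" and v: "v = norm v *\<^sub>R u" using False x by (auto simp: u_def)
      have "sqrt (G c x v v) = norm v * sqrt (G c x u u)"
        using metric_scale[OF assms(1), of x "norm v" u] x assms(3) v
        by (auto simp: real_sqrt_mult)
      moreover have "?N z1 \<le> sqrt (G c x u u)" "sqrt (G c x u u) \<le> ?N z2"
        using z1(2)[OF u] z2(2)[OF u] by auto
      ultimately show ?thesis
        by (simp add: mult.commute mult_left_mono)
    qed
  qed
qed (use that[of 1 1] in auto)

end

section \<open>Speed and length of curves\<close>

text \<open>
  This compares Euclidean displacement with Riemannian length: \<open>h\<close> will be the speed of a curve and \<open>g\<close>
  its coordinate expression. Integrating the component of \<open>g'\<close> in the direction \<open>e\<close> of the total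
  displacement reduces the claim to the fundamental theorem of calculus for real functions. If the
  right-hand side is finite, then the positive part of \<open>h\<close> is integrable on the interval.
\<close>
lemma scaled_increment_le_nn_integral:
  fixes g :: "real \<Rightarrow> 'b::euclidean_space"
  assumes "finite S" "a \<le> b" and cont: "continuous_on {a..b} g"
    and g': "\<And>t. t \<in> {a<..<b} - S \<Longrightarrow> (g has_vector_derivative g' t) (at t)"
    and bound: "\<And>t. t \<in> {a<..<b} - S \<Longrightarrow> \<kappa> * norm (g' t) \<le> h t"
    and \<kappa>: "\<kappa> > 0"
    and meas: "(\<lambda>t. ennreal (h t) * indicator {a..b} t) \<in> borel_measurable lborel"
  shows "ennreal (\<kappa> * norm (g b - g a)) \<le> (\<integral>\<^sup>+t\<in>{a..b}. ennreal (h t) \<partial>lborel)"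
proof (cases "g b = g a \<or> (\<integral>\<^sup>+t\<in>{a..b}. ennreal (h t) \<partial>lborel) = \<infinity>")
  case False
  define J where "J = (\<integral>\<^sup>+t\<in>{a..b}. ennreal (h t) \<partial>lborel)"
  define e where "e = (g b - g a) /\<^sub>R norm (g b - g a)"
  have e: "norm e = 1" "e \<bullet> (g b - g a) = norm (g b - g a)"
    using False by (auto simp: e_def divide_simps power2_norm_eq_inner[symmetric] power2_eq_square)
  define f' where "f' t = (if t \<in> {a<..<b} - S then e \<bullet> g' t else 0)" for t
  have "(f' has_integral (e \<bullet> g b - e \<bullet> g a)) {a..b}"
  proof (rule fundamental_theorem_of_calculus_interior_strong[OF \<open>finite S\<close> \<open>a \<le> b\<close>])
    show "((\<lambda>t. e \<bullet> g t) has_vector_derivative f' t) (at t)" if "t \<in> {a<..<b} - S" for t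
      using bounded_linear.has_vector_derivative[OF bounded_linear_inner_right g'[OF that]] that
      by (simp add: f'_def)
    show "continuous_on {a..b} (\<lambda>t. e \<bullet> g t)" using cont by (intro continuous_intros)
  qed
  then have f': "((\<lambda>t. if t \<in> {a..b} then \<kappa> * f' t else 0) has_integral \<kappa> * norm (g b - g a)) UNIV"
    unfolding has_integral_restrict_UNIV
    using e(2) by (auto simp: inner_diff_right intro: has_integral_mult_right)
  define F where "F t = enn2real (ennreal (h t) * indicator {a..b} t)" for t
  have F: "ennreal (F t) = ennreal (h t) * indicator {a..b} t" for t
    by (simp add: F_def indicator_def)
  have Fint: "integrable lborel F"
  proof (rule integrableI_nonneg)
    show "F \<in> borel_measurable lborel" unfolding F_def using meas by measurable
    show "(\<integral>\<^sup>+t. ennreal (F t) \<partial>lborel) < \<infinity>"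
      using False by (simp add: F less_top)
  qed (simp add: F_def)
  have "\<kappa> * norm (g b - g a) \<le> integral\<^sup>L lborel F"
  proof (rule has_integral_le[OF f' has_integral_integral_lborel[OF Fint]])
    fix t
    have "\<kappa> * f' t \<le> h t" if "t \<in> {a<..<b} - S"
    proof -
      have "e \<bullet> g' t \<le> norm (g' t)" using norm_cauchy_schwarz[of e "g' t"] e(1) by simp
      then show ?thesis using bound[OF that] \<kappa> that by (simp add: f'_def) (smt (verit) mult_left_mono)
    qed
    moreover have "F t = (if t \<in> {a..b} then max 0 (h t) else 0)"
      by (cases "h t \<ge> 0") (auto simp: F_def ennreal_neg)
    ultimately show "(if t \<in> {a..b} then \<kappa> * f' t else 0) \<le> F t"
      by (cases "t \<in> {a<..<b} - S") (auto simp: f'_def le_max_iff_disj)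
  qed
  moreover have "ennreal (integral\<^sup>L lborel F) = J"
    using nn_integral_eq_integral[OF Fint] by (simp add: F J_def) (simp add: F_def)
  ultimately show ?thesis unfolding J_def[symmetric] by (metis ennreal_leI)
qed auto

context riemannian_structure
begin

text \<open>
  By the invariance of the metric under transitions, the speed is the same in any chart, so it
  does not matter which chart the choice operator in \<open>curve_speed\<close> has picked.
\<close>
lemma curve_speed_in_chart:
  assumes c: "c \<in> A" and t: "\<gamma> t \<in> fst c" and near: "\<forall>\<^sub>F s in at t. \<gamma> s \<in> fst c"
    and deriv: "((snd c \<circ> \<gamma>) has_vector_derivative v) (at t)"
  shows "curve_speed A G \<gamma> t = sqrt (G c (snd c (\<gamma> t)) v v)"
proof -
  define c' where "c' = (SOME c. c \<in> A \<and> \<gamma> t \<in> fst c)"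
  have c': "c' \<in> A" "\<gamma> t \<in> fst c'"
    using someI[of "\<lambda>c. c \<in> A \<and> \<gamma> t \<in> fst c" c] c t by (auto simp: c'_def)
  have x: "snd c (\<gamma> t) \<in> overlap c c'" using t c' by (simp add: overlapI)
  let ?D = "transition_deriv c c' (snd c (\<gamma> t))"
  have recover: "(transition c c' \<circ> (snd c \<circ> \<gamma>)) s = (snd c' \<circ> \<gamma>) s" if "\<gamma> s \<in> fst c" for s
    using that by (simp add: transition_conv chart_inv_inverse[OF c])
  have "((transition c c' \<circ> (snd c \<circ> \<gamma>)) has_vector_derivative ?D v) (at t)"
    by (rule vector_derivative_diff_chain_within[OF deriv])
      (use transition_C1(1)[OF c c'(1) x] in \<open>auto intro: has_derivative_at_withinI\<close>)
  then have "((snd c' \<circ> \<gamma>) has_vector_derivative ?D v) (at t)"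
    unfolding has_vector_derivative_def
    by (rule has_derivative_transform_eventually) (use near recover t in \<open>auto elim: eventually_mono\<close>)
  then have "vector_derivative (snd c' \<circ> \<gamma>) (at t) = ?D v" by (rule vector_derivative_at)
  then have "curve_speed A G \<gamma> t = sqrt (G c' (snd c' (\<gamma> t)) (?D v) (?D v))"
    by (simp add: curve_speed_def c'_def[symmetric] Let_def)
  moreover have "snd c' (\<gamma> t) = transition c c' (snd c (\<gamma> t))" using recover[OF t] by simp
  ultimately show ?thesis using metric_transition[OF c c'(1) x, of v v] by simp
qed

lemma piecewise_C1_curveE:
  assumes "piecewise_C1_curve X A \<gamma> a b"
  obtains S where "a \<le> b" "continuous_map (top_of_set {a..b}) X \<gamma>" "finite S"
    "\<forall>p q. a \<le> p \<and> p < q \<and> q \<le> b \<and> {p<..<q} \<inter> S = {} \<longrightarrow> C1_curve A \<gamma> p q"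
  using assms unfolding piecewise_C1_curve_def by (elim conjE exE)

text \<open>
  Near a parameter that is not a break point, the speed has a single formula with continuous
  ingredients in any given chart around the point. Its measurability and the length estimates rest on
  this description.
\<close>
lemma curve_regular_at:
  assumes \<gamma>: "continuous_map (top_of_set {a..b}) X \<gamma>" and "finite S"
    and C1: "\<forall>p q. a \<le> p \<and> p < q \<and> q \<le> b \<and> {p<..<q} \<inter> S = {} \<longrightarrow> C1_curve A \<gamma> p q"
    and t: "t \<in> {a<..<b} - S" and c: "c \<in> A" "\<gamma> t \<in> fst c"
  obtains e v where "e > 0" "\<And>s. s \<in> ball t e \<Longrightarrow> s \<in> {a<..<b} - S \<and> \<gamma> s \<in> fst c \<and>
      ((snd c \<circ> \<gamma>) has_vector_derivative v s) (at s) \<and> curve_speed A G \<gamma> s = sqrt (G c (snd c (\<gamma> s)) (v s) (v s))"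
    "continuous_on (ball t e) v"
proof -
  have "openin (top_of_set {a..b}) {s \<in> topspace (top_of_set {a..b}). \<gamma> s \<in> fst c}"
    using \<gamma> chart_homeomorphism(1)[OF c(1)] by (rule openin_continuous_map_preimage)
  then obtain T where T: "open T" "{s \<in> {a..b}. \<gamma> s \<in> fst c} = {a..b} \<inter> T"
    by (auto simp: openin_open)
  have T2: "\<gamma> s \<in> fst c \<longleftrightarrow> s \<in> T" if "s \<in> {a..b}" for s
    using T(2) that by blast
  have "open (({a<..<b} - S) \<inter> T)"
    by (rule open_Int[OF open_Diff[OF open_greaterThanLessThan finite_imp_closed[OF \<open>finite S\<close>]] T(1)])
  moreover have "t \<in> ({a<..<b} - S) \<inter> T" using t c(2) T2[of t] by simp
  ultimately obtain e where e: "e > 0" "cball t e \<subseteq> ({a<..<b} - S) \<inter> T"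
    using open_contains_cball by blast
  then have sub: "{t - e..t + e} \<subseteq> ({a<..<b} - S) \<inter> T" by (simp add: cball_eq_atLeastAtMost)
  have "C1_curve A \<gamma> (t - e) (t + e)"
  proof (rule C1[rule_format], intro conjI)
    show "a \<le> t - e" "t + e \<le> b" using subsetD[OF sub, of "t - e"] subsetD[OF sub, of "t + e"] e(1) by simp_all
    show "t - e < t + e" using e by simp
    have "{t - e<..<t + e} \<subseteq> {t - e..t + e}" by auto
    then show "{t - e<..<t + e} \<inter> S = {}" using sub by blast
  qed
  then have "\<exists>v. (\<forall>s\<in>{t - e..t + e} \<inter> \<gamma> -` fst c.
        ((snd c \<circ> \<gamma>) has_vector_derivative v s) (at s within {t - e..t + e})) \<and>
        continuous_on ({t - e..t + e} \<inter> \<gamma> -` fst c) v"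
    using bspec[OF _ c(1)] unfolding C1_curve_def case_prod_unfold by blast
  then obtain v where v: "\<And>s. s \<in> {t - e..t + e} \<inter> \<gamma> -` fst c \<Longrightarrow>
        ((snd c \<circ> \<gamma>) has_vector_derivative v s) (at s within {t - e..t + e})"
      "continuous_on ({t - e..t + e} \<inter> \<gamma> -` fst c) v"
    by blast
  have ball: "s \<in> {t - e<..<t + e}" "s \<in> {a<..<b} - S" "\<gamma> s \<in> fst c" if "s \<in> ball t e" for s
  proof -
    show "s \<in> {t - e<..<t + e}" using that by (simp add: ball_eq_greaterThanLessThan)
    then have "s \<in> {t - e..t + e}" by auto
    then have "s \<in> {a<..<b} - S" "s \<in> T" using sub by blast+
    then show "s \<in> {a<..<b} - S" "\<gamma> s \<in> fst c" using T2[of s] by simp_all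
  qed
  have deriv: "((snd c \<circ> \<gamma>) has_vector_derivative v s) (at s)" if "s \<in> ball t e" for s
  proof -
    have "s \<in> interior {t - e..t + e}" using ball(1)[OF that] by simp
    moreover have "s \<in> {t - e..t + e} \<inter> \<gamma> -` fst c" using ball[OF that] by auto
    ultimately show ?thesis using v(1) by (metis at_within_interior)
  qed
  show ?thesis
  proof (rule that[OF e(1)])
    fix s assume s: "s \<in> ball t e"
    have "\<forall>\<^sub>F s' in at s. s' \<in> ball t e" using s by (intro eventually_at_in_open') auto
    then have near: "\<forall>\<^sub>F s' in at s. \<gamma> s' \<in> fst c" by (rule eventually_mono) (rule ball(3))
    show "s \<in> {a<..<b} - S \<and> \<gamma> s \<in> fst c \<and> ((snd c \<circ> \<gamma>) has_vector_derivative v s) (at s) \<and>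
        curve_speed A G \<gamma> s = sqrt (G c (snd c (\<gamma> s)) (v s) (v s))"
      using ball[OF s] deriv[OF s] curve_speed_in_chart[OF c(1) ball(3)[OF s] near deriv[OF s]] by simp
  next
    show "continuous_on (ball t e) v"
      by (rule continuous_on_subset[OF v(2)]) (use ball in force)
  qed
qed

lemma continuous_on_curve_speed:
  assumes \<gamma>: "continuous_map (top_of_set {a..b}) X \<gamma>" and "finite S"
    and C1: "\<forall>p q. a \<le> p \<and> p < q \<and> q \<le> b \<and> {p<..<q} \<inter> S = {} \<longrightarrow> C1_curve A \<gamma> p q"
  shows "continuous_on ({a<..<b} - S) (curve_speed A G \<gamma>)"
proof -
  have "isCont (curve_speed A G \<gamma>) t" if t: "t \<in> {a<..<b} - S" for t
  proof -
    have "\<gamma> t \<in> topspace X" using \<gamma> t by (auto simp: continuous_map_def Pi_iff)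
    then obtain c where c: "c \<in> A" "\<gamma> t \<in> fst c" using ex_chart by blast
    obtain e v where e: "e > 0" and ev: "\<And>s. s \<in> ball t e \<Longrightarrow> s \<in> {a<..<b} - S \<and> \<gamma> s \<in> fst c \<and>
        ((snd c \<circ> \<gamma>) has_vector_derivative v s) (at s) \<and> curve_speed A G \<gamma> s = sqrt (G c (snd c (\<gamma> s)) (v s) (v s))"
      and v: "continuous_on (ball t e) v"
      using curve_regular_at[OF \<gamma> \<open>finite S\<close> C1 t c] by blast
    have "continuous_on (ball t e) (snd c \<circ> \<gamma>)"
      using ev has_vector_derivative_continuous
      by (intro continuous_at_imp_continuous_on) blast
    then have "continuous_on (ball t e) (\<lambda>s. ((snd c \<circ> \<gamma>) s, v s))"
      using v by (intro continuous_on_Pair)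
    then have "continuous_on (ball t e) (\<lambda>s. case ((snd c \<circ> \<gamma>) s, v s) of (x, v) \<Rightarrow> G c x v v)"
      using ev by (intro continuous_on_compose2[OF continuous_on_metric[OF c(1)]]) auto
    then have "continuous_on (ball t e) (\<lambda>s. sqrt (G c (snd c (\<gamma> s)) (v s) (v s)))"
      by (intro continuous_on_real_sqrt) simp
    then have "continuous_on (ball t e) (curve_speed A G \<gamma>)"
      by (rule continuous_on_eq) (use ev in metis)
    then show ?thesis using e by (simp add: continuous_on_eq_continuous_at)
  qed
  then show ?thesis by (intro continuous_at_imp_continuous_on) blast
qed

text \<open>
  Additivity of length under subdivision depends on this: without measurability, the nonnegative
  integral may fail to be additive.
\<close>
lemma measurable_curve_speed:
  assumes "piecewise_C1_curve X A \<gamma> a b"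
  shows "(\<lambda>t. ennreal (curve_speed A G \<gamma> t) * indicator {a..b} t) \<in> borel_measurable lborel"
proof -
  obtain S where "a \<le> b" and \<gamma>: "continuous_map (top_of_set {a..b}) X \<gamma>" and S: "finite S"
    and C1: "\<forall>p q. a \<le> p \<and> p < q \<and> q \<le> b \<and> {p<..<q} \<inter> S = {} \<longrightarrow> C1_curve A \<gamma> p q"
    using piecewise_C1_curveE[OF assms] .
  have "(\<lambda>t. indicator ({a<..<b} - S) t *\<^sub>R curve_speed A G \<gamma> t) \<in> borel_measurable borel"
    by (rule borel_measurable_continuous_on_indicator[OF _ continuous_on_curve_speed[OF \<gamma> S C1]])
      (intro borel_open open_Diff open_greaterThanLessThan finite_imp_closed[OF S])
  then have "(\<lambda>t. ennreal (indicator ({a<..<b} - S) t *\<^sub>R curve_speed A G \<gamma> t)) \<in> borel_measurable lborel"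
    by measurable
  then show ?thesis
    by (rule measurable_discrete_difference[where X = "S \<union> {a, b}"])
      (use S in \<open>auto simp: indicator_def intro: countable_finite\<close>)
qed

lemma C1_curve_cong:
  assumes "\<And>s. s \<in> {p..q} \<Longrightarrow> \<gamma> s = \<gamma>' s"
  shows "C1_curve A \<gamma> p q \<longleftrightarrow> C1_curve A \<gamma>' p q"
proof -
  have "C1_curve A \<gamma>' p q" if C1: "C1_curve A \<gamma> p q" and eq: "\<And>s. s \<in> {p..q} \<Longrightarrow> \<gamma> s = \<gamma>' s"
    for \<gamma> \<gamma>' :: "real \<Rightarrow> 'a"
    unfolding C1_curve_def
  proof (clarify)
    fix U \<phi> assume "(U, \<phi>) \<in> A"
    then obtain v where v: "\<And>s. s \<in> {p..q} \<inter> \<gamma> -` U \<Longrightarrow>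
        ((\<phi> \<circ> \<gamma>) has_vector_derivative v s) (at s within {p..q})"
      "continuous_on ({p..q} \<inter> \<gamma> -` U) v"
      using C1 unfolding C1_curve_def by blast
    have set: "{p..q} \<inter> \<gamma>' -` U = {p..q} \<inter> \<gamma> -` U" using eq by auto
    show "\<exists>v. (\<forall>s\<in>{p..q} \<inter> \<gamma>' -` U. ((\<phi> \<circ> \<gamma>') has_vector_derivative v s) (at s within {p..q})) \<and>
        continuous_on ({p..q} \<inter> \<gamma>' -` U) v"
      unfolding set
    proof (intro exI[of _ v] conjI ballI v(2))
      fix s assume s: "s \<in> {p..q} \<inter> \<gamma> -` U"
      show "((\<phi> \<circ> \<gamma>') has_vector_derivative v s) (at s within {p..q})"
        by (rule has_vector_derivative_transform[OF _ _ v(1)[OF s]]) (use s eq in auto)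
    qed
  qed
  then show ?thesis using assms by metis
qed

lemma piecewise_C1_subcurve:
  assumes "piecewise_C1_curve X A \<gamma> a b" "a \<le> a'" "a' \<le> b'" "b' \<le> b"
  shows "piecewise_C1_curve X A \<gamma> a' b'"
proof -
  have "{a'..b'} \<subseteq> {a..b}" using assms by auto
  then have "continuous_map (top_of_set {a'..b'}) X \<gamma>"
    using assms(1) by (metis continuous_map_from_subtopology_mono piecewise_C1_curve_def)
  moreover obtain S where "a \<le> b" "continuous_map (top_of_set {a..b}) X \<gamma>" "finite S"
    "\<forall>p q. a \<le> p \<and> p < q \<and> q \<le> b \<and> {p<..<q} \<inter> S = {} \<longrightarrow> C1_curve A \<gamma> p q"
    using piecewise_C1_curveE[OF assms(1)] .
  ultimately show ?thesis
    unfolding piecewise_C1_curve_def using assms(2-4) by (intro conjI exI[of _ S]) auto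
qed

lemma curve_length_split:
  assumes "piecewise_C1_curve X A \<gamma> a b" "a \<le> s" "s \<le> b"
  shows "curve_length A G \<gamma> a b = curve_length A G \<gamma> a s + curve_length A G \<gamma> s b"
proof -
  have "(\<lambda>t. ennreal (curve_speed A G \<gamma> t) * indicator {a..s} t) \<in> borel_measurable lborel"
    by (rule measurable_curve_speed, rule piecewise_C1_subcurve[OF assms(1)]) (use assms(2,3) in simp_all)
  moreover have "(\<lambda>t. ennreal (curve_speed A G \<gamma> t) * indicator {s..b} t) \<in> borel_measurable lborel"
    by (rule measurable_curve_speed, rule piecewise_C1_subcurve[OF assms(1)]) (use assms(2,3) in simp_all)
  moreover have "curve_length A G \<gamma> a b =
      (\<integral>\<^sup>+t. ennreal (curve_speed A G \<gamma> t) * indicator {a..s} t + ennreal (curve_speed A G \<gamma> t) * indicator {s..b} t \<partial>lborel)"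
    unfolding curve_length_def
    by (rule nn_integral_cong_AE, use AE_lborel_singleton[of s] in eventually_elim)
      (use assms in \<open>auto simp: indicator_def\<close>)
  ultimately show ?thesis by (simp add: curve_length_def nn_integral_add)
qed

lemma curve_length_cong:
  assumes "\<And>t. t \<in> {a<..<b} \<Longrightarrow> \<gamma> t = \<gamma>' t"
  shows "curve_length A G \<gamma> a b = curve_length A G \<gamma>' a b"
proof -
  have "curve_speed A G \<gamma> t = curve_speed A G \<gamma>' t" if t: "t \<in> {a<..<b}" for t
  proof -
    have ev: "\<forall>\<^sub>F s in nhds t. \<gamma> s = \<gamma>' s"
      using eventually_nhds_in_open[of "{a<..<b}" t] t assms by (auto elim: eventually_mono)
    have "vector_derivative (\<phi> \<circ> \<gamma>) (at t) = vector_derivative (\<phi> \<circ> \<gamma>') (at t)" for \<phi> :: "'a \<Rightarrow> real ^ 'n"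
      by (rule vector_derivative_cong_eq) (use ev in \<open>auto elim: eventually_mono\<close>)
    then show ?thesis using assms[OF t] by (simp add: curve_speed_def Let_def)
  qed
  then show ?thesis unfolding curve_length_def
    by (intro nn_integral_cong_AE, use AE_lborel_singleton[of a] AE_lborel_singleton[of b] in eventually_elim)
      (auto simp: indicator_def)
qed

section \<open>The Riemannian distance in coordinates\<close>

abbreviation "d \<equiv> riemannian_distance X A G"

lemma distance_le_curve_length:
  "piecewise_C1_curve X A \<gamma> a b \<Longrightarrow> d (\<gamma> a) (\<gamma> b) \<le> curve_length A G \<gamma> a b"
  unfolding riemannian_distance_def by (intro Inf_lower) auto

lemma distance_lessE:
  assumes "d p q < r"
  obtains \<gamma> a b where "piecewise_C1_curve X A \<gamma> a b" "\<gamma> a = p" "\<gamma> b = q" "curve_length A G \<gamma> a b < r"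
  using assms unfolding riemannian_distance_def Inf_less_iff by blast

lemma distance_self:
  assumes "p \<in> topspace X"
  shows "d p p = 0"
proof -
  have "piecewise_C1_curve X A (\<lambda>_. p) 0 0"
    using assms by (auto simp: piecewise_C1_curve_def intro!: exI[of _ "{}"])
  from distance_le_curve_length[OF this] have "d p p \<le> curve_length A G (\<lambda>_. p) 0 0" .
  also have "AE t in lborel. ennreal (curve_speed A G (\<lambda>_. p) t) * indicator {0..0} t = 0"
    using AE_lborel_singleton[of "0::real"] by eventually_elim auto
  then have "curve_length A G (\<lambda>_. p) 0 0 = 0"
    unfolding curve_length_def by (subst nn_integral_cong_AE) auto
  finally show ?thesis by simp
qed

text \<open>
  The triangle inequality, at the level of curves. Adjacent parameter intervals are no restriction
  when one of the curves is a coordinate segment, which can start at any time.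
\<close>
lemma distance_le_concatenation:
  assumes \<gamma>1: "piecewise_C1_curve X A \<gamma>1 a b" and \<gamma>2: "piecewise_C1_curve X A \<gamma>2 b e"
    and join: "\<gamma>1 b = \<gamma>2 b"
  shows "d (\<gamma>1 a) (\<gamma>2 e) \<le> curve_length A G \<gamma>1 a b + curve_length A G \<gamma>2 b e"
proof -
  define \<gamma> where "\<gamma> t = (if t \<le> b then \<gamma>1 t else \<gamma>2 t)" for t
  obtain S1 where ab1: "a \<le> b" and cont1: "continuous_map (top_of_set {a..b}) X \<gamma>1" and S1: "finite S1"
    "\<forall>p q. a \<le> p \<and> p < q \<and> q \<le> b \<and> {p<..<q} \<inter> S1 = {} \<longrightarrow> C1_curve A \<gamma>1 p q"
    using piecewise_C1_curveE[OF \<gamma>1] .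
  obtain S2 where ab2: "b \<le> e" and cont2: "continuous_map (top_of_set {b..e}) X \<gamma>2" and S2: "finite S2"
    "\<forall>p q. b \<le> p \<and> p < q \<and> q \<le> e \<and> {p<..<q} \<inter> S2 = {} \<longrightarrow> C1_curve A \<gamma>2 p q"
    using piecewise_C1_curveE[OF \<gamma>2] .
  note ab = ab1 ab2
  have right: "\<gamma> t = \<gamma>2 t" if "b \<le> t" for t using that join by (auto simp: \<gamma>_def)
  have "continuous_map (top_of_set {a..e}) X (\<lambda>t. if t \<le> b then \<gamma>1 t else \<gamma>2 t)"
  proof (rule continuous_map_cases_le)
    have "{t \<in> topspace (top_of_set {a..e}). t \<le> b} = {a..b}"
      "{t \<in> topspace (top_of_set {a..e}). b \<le> t} = {b..e}" using ab by auto
    then show "continuous_map (subtopology (top_of_set {a..e}) {t \<in> topspace (top_of_set {a..e}). t \<le> b}) X \<gamma>1"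
      "continuous_map (subtopology (top_of_set {a..e}) {t \<in> topspace (top_of_set {a..e}). b \<le> t}) X \<gamma>2"
      using cont1 cont2 ab by (auto simp: subtopology_subtopology Int_absorb1)
  qed (use join in auto)
  moreover have "C1_curve A \<gamma> p q" if pq: "a \<le> p" "p < q" "q \<le> e" "{p<..<q} \<inter> (S1 \<union> S2 \<union> {b}) = {}" for p q
  proof (cases "q \<le> b")
    case True
    have "C1_curve A \<gamma>1 p q" using True pq by (intro S1(2)[rule_format]) auto
    moreover have "\<gamma> s = \<gamma>1 s" if "s \<in> {p..q}" for s using that True by (simp add: \<gamma>_def)
    ultimately show ?thesis using C1_curve_cong by blast
  next
    case False
    then have "b \<le> p" using pq(4) by (cases "b \<le> p") auto
    have "C1_curve A \<gamma>2 p q" using \<open>b \<le> p\<close> pq by (intro S2(2)[rule_format]) auto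
    moreover have "\<gamma> s = \<gamma>2 s" if "s \<in> {p..q}" for s using that \<open>b \<le> p\<close> by (intro right) auto
    ultimately show ?thesis using C1_curve_cong by blast
  qed
  ultimately have \<gamma>: "piecewise_C1_curve X A \<gamma> a e"
    unfolding piecewise_C1_curve_def using ab S1(1) S2(1)
    by (intro conjI exI[of _ "S1 \<union> S2 \<union> {b}"]) (auto simp: \<gamma>_def[abs_def])
  have "curve_length A G \<gamma> a b = curve_length A G \<gamma>1 a b"
    "curve_length A G \<gamma> b e = curve_length A G \<gamma>2 b e"
    by (auto intro!: curve_length_cong simp: \<gamma>_def)
  then show ?thesis
    using distance_le_curve_length[OF \<gamma>] curve_length_split[OF \<gamma> ab] right[OF ab(2)] ab(1)
    by (simp add: \<gamma>_def)
qed

text \<open>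
  The starting time \<open>t0\<close> is free, so that a segment can be attached to either end of a given curve.
\<close>
lemma segment_curve:
  fixes t0 :: real
  assumes c: "c \<in> A" and K: "convex K" "K \<subseteq> snd c ` fst c" and uv: "u \<in> K" "v \<in> K"
    and C: "\<And>x w. x \<in> K \<Longrightarrow> sqrt (G c x w w) \<le> C * norm w"
  obtains \<sigma> where "piecewise_C1_curve X A \<sigma> t0 (t0 + 1)" "\<sigma> t0 = chart_inv c u"
    "\<sigma> (t0 + 1) = chart_inv c v" "curve_length A G \<sigma> t0 (t0 + 1) \<le> ennreal (C * norm (v - u))"
proof -
  define line where "line s = u + (s - t0) *\<^sub>R (v - u)" for s
  define \<sigma> where "\<sigma> = chart_inv c \<circ> line"
  have line_K: "line s \<in> K" if "s \<in> {t0..t0 + 1}" for s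
  proof -
    have "line s = (1 - (s - t0)) *\<^sub>R u + (s - t0) *\<^sub>R v" by (simp add: line_def algebra_simps)
    then show ?thesis using convexD_alt[OF K(1) uv, of "s - t0"] that by simp
  qed
  have line_deriv: "(line has_vector_derivative (v - u)) (at s within T)" for s T
    unfolding line_def by (auto intro!: derivative_eq_intros)
  have line_cont: "continuous_on T line" for T
    unfolding line_def by (intro continuous_intros)
  have \<sigma>_chart: "\<sigma> s \<in> fst c" "snd c (\<sigma> s) = line s" if "s \<in> {t0..t0 + 1}" for s
    using chart_inv_inverse(2,3)[OF c] line_K[OF that] K(2) by (auto simp: \<sigma>_def)
  have "continuous_map (top_of_set {t0..t0 + 1}) (top_of_set (snd c ` fst c)) line"
    using line_cont line_K K(2) by auto
  then have cont: "continuous_map (top_of_set {t0..t0 + 1}) X \<sigma>"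
    unfolding \<sigma>_def using chart_homeomorphism(6)[OF c] by (rule continuous_map_compose)
  have C1: "C1_curve A \<sigma> p q" if pq: "t0 \<le> p" "q \<le> t0 + 1" for p q
    unfolding C1_curve_def case_prod_unfold
  proof (intro ballI)
    fix c' assume c': "c' \<in> A"
    have over: "line s \<in> overlap c c'" if "s \<in> {p..q} \<inter> \<sigma> -` fst c'" for s
    proof -
      have s: "s \<in> {t0..t0 + 1}" "\<sigma> s \<in> fst c'" using that pq by auto
      then show ?thesis using overlapI[of "\<sigma> s" c c'] \<sigma>_chart[OF s(1)] by simp
    qed
    \<comment> \<open>This holds on all of \<open>\<real>\<close>, even where \<open>line\<close> leaves the chart, as both sides contain \<open>chart_inv c\<close>.\<close>
    have eq: "snd c' \<circ> \<sigma> = transition c c' \<circ> line"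
      by (simp add: \<sigma>_def transition_conv comp_assoc)
    let ?w = "\<lambda>s. transition_deriv c c' (line s) (v - u)"
    have "((snd c' \<circ> \<sigma>) has_vector_derivative ?w s) (at s within {p..q})"
      if s: "s \<in> {p..q} \<inter> \<sigma> -` fst c'" for s
      unfolding eq
      by (rule vector_derivative_diff_chain_within[OF line_deriv has_derivative_at_withinI[OF transition_C1(1)[OF c c' over[OF s]]]])
    moreover have "continuous_on ({p..q} \<inter> \<sigma> -` fst c') ?w"
      by (rule continuous_on_compose2[OF transition_C1(2)[OF c c'] line_cont]) (use over in blast)
    ultimately show "\<exists>w. (\<forall>s\<in>{p..q} \<inter> \<sigma> -` fst c'. ((snd c' \<circ> \<sigma>) has_vector_derivative w s) (at s within {p..q})) \<and>
        continuous_on ({p..q} \<inter> \<sigma> -` fst c') w"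
      by (intro exI[of _ ?w] conjI ballI)
  qed
  have pw: "piecewise_C1_curve X A \<sigma> t0 (t0 + 1)"
    unfolding piecewise_C1_curve_def using cont C1 by (intro conjI exI[of _ "{}"]) auto
  have speed: "curve_speed A G \<sigma> t \<le> C * norm (v - u)" if t: "t \<in> {t0<..<t0 + 1}" for t
  proof -
    have ev: "\<forall>\<^sub>F s in nhds t. s \<in> {t0<..<t0 + 1}"
      using t by (intro eventually_nhds_in_open) auto
    then have "\<forall>\<^sub>F s in at t. \<sigma> s \<in> fst c"
      unfolding eventually_at_filter by (rule eventually_mono) (use \<sigma>_chart(1) in auto)
    moreover have "(snd c \<circ> \<sigma> has_vector_derivative (v - u)) (at t)"
      using line_deriv[of t UNIV] unfolding has_vector_derivative_def
      by (rule has_derivative_transform_within_open[of _ _ _ _ "{t0<..<t0 + 1}"])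
        (use t \<sigma>_chart(2) in auto)
    ultimately have "curve_speed A G \<sigma> t = sqrt (G c (snd c (\<sigma> t)) (v - u) (v - u))"
      using t \<sigma>_chart(1)[of t] by (intro curve_speed_in_chart[OF c]) auto
    then show ?thesis using C[of "line t" "v - u"] line_K[of t] \<sigma>_chart(2)[of t] t by simp
  qed
  have "curve_length A G \<sigma> t0 (t0 + 1) \<le> (\<integral>\<^sup>+t. ennreal (C * norm (v - u)) * indicator {t0..t0 + 1} t \<partial>lborel)"
    unfolding curve_length_def
  proof (rule nn_integral_mono_AE)
    show "AE t in lborel. ennreal (curve_speed A G \<sigma> t) * indicator {t0..t0 + 1} t
        \<le> ennreal (C * norm (v - u)) * indicator {t0..t0 + 1} t"
      using AE_lborel_singleton[of t0] AE_lborel_singleton[of "t0 + 1"]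
      by eventually_elim (auto simp: indicator_def intro!: ennreal_leI speed)
  qed
  also have "\<dots> = ennreal (C * norm (v - u))"
    by (simp add: nn_integral_cmult_indicator)
  finally show ?thesis using that[OF pw] by (simp add: \<sigma>_def line_def)
qed

text \<open>
  Let \<open>s\<close> be the last time at which the curve is outside the open coordinate ball. Afterwards it stays
  in that ball, so at time \<open>s\<close> it is in the closed one, because the corresponding compact subset of \<open>X\<close>
  is closed in the Hausdorff space \<open>X\<close>. Hence \<open>\<gamma> s\<close> is on the boundary, and the rest of the
  curve covers a coordinate distance \<open>R\<close> inside the chart.
\<close>
lemma curve_enters_chart_ball:
  assumes c: "c \<in> A" and y: "y \<in> fst c" and K: "K \<subseteq> snd c ` fst c" "cball (snd c y) R \<subseteq> K"
    and \<kappa>: "\<kappa> > 0" "\<And>x w. x \<in> K \<Longrightarrow> \<kappa> * norm w \<le> sqrt (G c x w w)"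
    and \<gamma>: "piecewise_C1_curve X A \<gamma> a b" "\<gamma> b = y"
    and outside: "\<not> (\<gamma> a \<in> fst c \<and> snd c (\<gamma> a) \<in> ball (snd c y) R)" and "R > 0"
  obtains s where "a \<le> s" "s \<le> b" "\<gamma> s \<in> fst c" "dist (snd c y) (snd c (\<gamma> s)) = R"
    "ennreal (\<kappa> * R) \<le> curve_length A G \<gamma> s b"
proof -
  obtain S where ab: "a \<le> b" and cont: "continuous_map (top_of_set {a..b}) X \<gamma>" and S: "finite S"
    "\<forall>p q. a \<le> p \<and> p < q \<and> q \<le> b \<and> {p<..<q} \<inter> S = {} \<longrightarrow> C1_curve A \<gamma> p q"
    using piecewise_C1_curveE[OF \<gamma>(1)] .
  define V where "V = {q \<in> fst c. snd c q \<in> ball (snd c y) R}"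
  have V: "openin X V" unfolding V_def by (rule openin_chart_preimage[OF c open_ball])
  have closed_pre: "closed {t \<in> {a..b}. \<gamma> t \<in> Z}" if "closedin X Z" for Z
    using closedin_continuous_map_preimage[OF cont that] by (simp add: closedin_closed_eq)
  have in_X: "\<gamma> t \<in> topspace X" if "t \<in> {a..b}" for t
    using cont that by (auto simp: continuous_map_def Pi_iff)
  let ?E = "{t \<in> {a..b}. \<gamma> t \<in> topspace X - V}"
  have "closed ?E"
    by (rule closed_pre) (rule closedin_diff[OF closedin_topspace V])
  moreover have "bounded ?E" by (rule bounded_subset[OF bounded_closed_interval[of a b]]) blast
  ultimately have "compact ?E" by (simp only: compact_eq_bounded_closed)
  moreover have "a \<in> ?E" using in_X[of a] ab outside by (simp add: V_def)
  ultimately obtain s where s: "s \<in> ?E" "\<And>t. t \<in> ?E \<Longrightarrow> t \<le> s"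
    using compact_attains_sup[of ?E] by blast
  have after: "\<gamma> t \<in> V" if "s < t" "t \<le> b" for t
    using s(1) s(2)[of t] that in_X[of t] by force
  have "\<gamma> b \<in> V" using \<gamma>(2) y \<open>R > 0\<close> by (simp add: V_def)
  then have sb: "s < b" using s(1) by (cases "s = b") auto
  let ?K = "chart_inv c ` cball (snd c y) R"
  have "compactin (top_of_set (snd c ` fst c)) (cball (snd c y) R)"
    using K by (simp add: compactin_subtopology)
  then have "closedin X ?K"
    using image_compactin[OF _ chart_homeomorphism(6)[OF c]] compactin_imp_closedin[OF Hausdorff] by blast
  then have F: "closed {t \<in> {a..b}. \<gamma> t \<in> ?K}" by (rule closed_pre)
  have VK: "V \<subseteq> ?K"
  proof
    fix q assume "q \<in> V"
    then have "q = chart_inv c (snd c q)" "snd c q \<in> cball (snd c y) R"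
      using chart_inv_inverse(1)[OF c] by (auto simp: V_def)
    then show "q \<in> ?K" by blast
  qed
  have "{s<..b} \<subseteq> {t \<in> {a..b}. \<gamma> t \<in> ?K}" using after VK s(1) by force
  then have "closure {s<..b} \<subseteq> {t \<in> {a..b}. \<gamma> t \<in> ?K}" using F by (rule closure_minimal)
  then have sub: "{s..b} \<subseteq> {t \<in> {a..b}. \<gamma> t \<in> ?K}" using sb by simp
  have stay: "\<gamma> t \<in> fst c" "snd c (\<gamma> t) \<in> cball (snd c y) R" if t: "t \<in> {s..b}" for t
  proof -
    obtain u where u: "u \<in> cball (snd c y) R" "\<gamma> t = chart_inv c u" using subsetD[OF sub t] by blast
    then have "u \<in> snd c ` fst c" using K by blast
    then show "\<gamma> t \<in> fst c" "snd c (\<gamma> t) \<in> cball (snd c y) R"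
      using chart_inv_inverse(2,3)[OF c] u by auto
  qed
  have s_in: "s \<in> {s..b}" "a \<le> s" using sb s(1) by auto
  have "\<gamma> s \<notin> V" using s(1) by blast
  then have dist: "dist (snd c y) (snd c (\<gamma> s)) = R"
    using stay[OF s_in(1)] by (simp add: V_def)
  have pw: "piecewise_C1_curve X A \<gamma> s b"
    by (rule piecewise_C1_subcurve[OF \<gamma>(1)]) (use s_in sb in auto)
  have cont_s: "continuous_map (top_of_set {s..b}) X \<gamma>"
    using continuous_map_from_subtopology_mono[OF cont] s_in by auto
  have "ennreal (\<kappa> * norm ((snd c \<circ> \<gamma>) b - (snd c \<circ> \<gamma>) s)) \<le> (\<integral>\<^sup>+t\<in>{s..b}. ennreal (curve_speed A G \<gamma> t) \<partial>lborel)"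
  proof (rule scaled_increment_le_nn_integral[OF S(1) _ _ _ _ \<kappa>(1) measurable_curve_speed[OF pw]])
    show "s \<le> b" using sb by simp
    have "continuous_map (top_of_set {s..b}) (subtopology X (fst c)) \<gamma>"
      using cont_s stay(1) by (intro continuous_map_into_subtopology) auto
    then have "continuous_map (top_of_set {s..b}) euclidean (snd c \<circ> \<gamma>)"
      using chart_homeomorphism(5)[OF c] by (rule continuous_map_compose)
    then show "continuous_on {s..b} (snd c \<circ> \<gamma>)" by simp
    fix t assume t: "t \<in> {s<..<b} - S"
    then have t': "t \<in> {s..b}" "t \<in> {a<..<b} - S" using s_in by auto
    obtain e v where "e > 0" and ev: "\<And>s. s \<in> ball t e \<Longrightarrow> s \<in> {a<..<b} - S \<and> \<gamma> s \<in> fst c \<and>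
        ((snd c \<circ> \<gamma>) has_vector_derivative v s) (at s) \<and> curve_speed A G \<gamma> s = sqrt (G c (snd c (\<gamma> s)) (v s) (v s))"
      using curve_regular_at[OF cont S t'(2) c stay(1)[OF t'(1)]] by metis
    then have d: "((snd c \<circ> \<gamma>) has_vector_derivative v t) (at t)"
      "curve_speed A G \<gamma> t = sqrt (G c (snd c (\<gamma> t)) (v t) (v t))"
      using ev[of t] by auto
    from d(1) show "((snd c \<circ> \<gamma>) has_vector_derivative vector_derivative (snd c \<circ> \<gamma>) (at t)) (at t)"
      by (simp add: vector_derivative_at)
    show "\<kappa> * norm (vector_derivative (snd c \<circ> \<gamma>) (at t)) \<le> curve_speed A G \<gamma> t"
      using d(2) vector_derivative_at[OF d(1)] \<kappa>(2)[of "snd c (\<gamma> t)"] stay(2)[OF t'(1)] K(2) by auto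
  qed
  then have "ennreal (\<kappa> * R) \<le> curve_length A G \<gamma> s b"
    using dist \<gamma>(2) by (simp add: curve_length_def dist_norm)
  then show ?thesis using that[of s] s_in sb stay(1)[OF s_in(1)] dist by auto
qed

lemma chart_constants:
  assumes "c \<in> A" "x \<in> snd c ` fst c"
  obtains r \<kappa> C where "0 < r" "0 < \<kappa>" "0 < C" "cball x r \<subseteq> snd c ` fst c"
    "\<forall>z\<in>cball x r. \<forall>w. \<kappa> * norm w \<le> sqrt (G c z w w) \<and> sqrt (G c z w w) \<le> C * norm w"
proof -
  obtain r where r: "0 < r" "cball x r \<subseteq> snd c ` fst c"
    using chart_homeomorphism(3)[OF assms(1)] assms(2) open_contains_cball by blast
  show ?thesis
    by (rule metric_bounds_on_compact[OF assms(1) compact_cball r(2)]) (rule that[OF r(1) _ _ r(2)], blast+)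
qed

text \<open>
  To move the second argument of \<open>d\<close>, append a coordinate segment to a nearly shortest curve; to move the
  first one, prepend it.
\<close>
lemma distance_segment_bounds:
  assumes c: "c \<in> A" and K: "convex K" "K \<subseteq> snd c ` fst c" and uv: "u \<in> K" "v \<in> K"
    and C: "\<And>x w. x \<in> K \<Longrightarrow> sqrt (G c x w w) \<le> C * norm w"
  shows "d p (chart_inv c v) \<le> d p (chart_inv c u) + ennreal (C * dist u v)"
    "d (chart_inv c u) q \<le> ennreal (C * dist u v) + d (chart_inv c v) q"
proof -
  let ?e = "ennreal (C * dist u v)"
  have C1: "d p (chart_inv c v) \<le> L + ?e" if "d p (chart_inv c u) < L" for L
  proof -
    obtain \<gamma> a b where \<gamma>: "piecewise_C1_curve X A \<gamma> a b" "\<gamma> a = p" "\<gamma> b = chart_inv c u"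
      "curve_length A G \<gamma> a b < L" using distance_lessE[OF \<open>d p (chart_inv c u) < L\<close>] .
    obtain \<sigma> where \<sigma>: "piecewise_C1_curve X A \<sigma> b (b + 1)" "\<sigma> b = chart_inv c u" "\<sigma> (b + 1) = chart_inv c v"
      "curve_length A G \<sigma> b (b + 1) \<le> ennreal (C * norm (v - u))"
      using segment_curve[OF c K uv C] .
    have "d (\<gamma> a) (\<sigma> (b + 1)) \<le> curve_length A G \<gamma> a b + curve_length A G \<sigma> b (b + 1)"
      by (rule distance_le_concatenation[OF \<gamma>(1) \<sigma>(1)]) (simp add: \<gamma>(3) \<sigma>(2))
    also have "\<dots> \<le> L + ?e"
      using \<gamma>(4) \<sigma>(4) by (intro add_mono) (auto simp: dist_norm norm_minus_commute)
    finally show ?thesis by (simp add: \<gamma>(2) \<sigma>(3))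
  qed
  have C2: "d (chart_inv c u) q \<le> ?e + L" if "d (chart_inv c v) q < L" for L
  proof -
    obtain \<gamma> a b where \<gamma>: "piecewise_C1_curve X A \<gamma> a b" "\<gamma> a = chart_inv c v" "\<gamma> b = q"
      "curve_length A G \<gamma> a b < L" using distance_lessE[OF \<open>d (chart_inv c v) q < L\<close>] .
    obtain \<sigma> where \<sigma>: "piecewise_C1_curve X A \<sigma> (a - 1) (a - 1 + 1)" "\<sigma> (a - 1) = chart_inv c u"
      "\<sigma> (a - 1 + 1) = chart_inv c v" "curve_length A G \<sigma> (a - 1) (a - 1 + 1) \<le> ennreal (C * norm (v - u))"
      using segment_curve[OF c K uv C] .
    have "d (\<sigma> (a - 1)) (\<gamma> b) \<le> curve_length A G \<sigma> (a - 1) a + curve_length A G \<gamma> a b"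
      using \<sigma> by (intro distance_le_concatenation[OF _ \<gamma>(1)]) (simp_all add: \<gamma>(2))
    also have "\<dots> \<le> ?e + L"
      using \<gamma>(4) \<sigma>(4) by (intro add_mono) (auto simp: dist_norm norm_minus_commute)
    finally show ?thesis by (simp add: \<gamma>(3) \<sigma>(2))
  qed
  show "d p (chart_inv c v) \<le> d p (chart_inv c u) + ?e"
  proof (rule ennreal_le_epsilon)
    fix e :: real assume "d p (chart_inv c u) + ?e < top" "0 < e"
    then have "d p (chart_inv c u) < d p (chart_inv c u) + ennreal e" by (cases "d p (chart_inv c u)") (auto simp: ennreal_less_iff simp flip: ennreal_plus)
    from C1[OF this] show "d p (chart_inv c v) \<le> d p (chart_inv c u) + ?e + ennreal e"
      by (simp add: ac_simps)
  qed
  show "d (chart_inv c u) q \<le> ?e + d (chart_inv c v) q"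
  proof (rule ennreal_le_epsilon)
    fix e :: real assume "?e + d (chart_inv c v) q < top" "0 < e"
    then have "d (chart_inv c v) q < d (chart_inv c v) q + ennreal e" by (cases "d (chart_inv c v) q") (auto simp: ennreal_less_iff simp flip: ennreal_plus)
    from C2[OF this] show "d (chart_inv c u) q \<le> ?e + d (chart_inv c v) q + ennreal e"
      by (simp add: ac_simps)
  qed
qed

lemma small_distance_perturbation:
  assumes x: "x \<in> topspace X" and e: "0 < e"
  obtains V where "openin X V" "x \<in> V"
    "\<And>y p. y \<in> V \<Longrightarrow> d p y \<le> d p x + ennreal e" "\<And>y q. y \<in> V \<Longrightarrow> d y q \<le> ennreal e + d x q"
proof -
  obtain c where c: "c \<in> A" "x \<in> fst c" using ex_chart[OF x] by blast
  then have "snd c x \<in> snd c ` fst c" by blast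
  obtain r \<kappa> C where r: "0 < r" "0 < \<kappa>" "0 < C" "cball (snd c x) r \<subseteq> snd c ` fst c"
    and bounds: "\<forall>z\<in>cball (snd c x) r. \<forall>w. \<kappa> * norm w \<le> sqrt (G c z w w) \<and> sqrt (G c z w w) \<le> C * norm w"
    using chart_constants[OF c(1) \<open>snd c x \<in> snd c ` fst c\<close>] .
  have C: "sqrt (G c z w w) \<le> C * norm w" if "z \<in> cball (snd c x) r" for z w
    using bounds that by blast
  define V where "V = {q \<in> fst c. snd c q \<in> ball (snd c x) (min r (e / C))}"
  have near: "snd c y \<in> cball (snd c x) r" "chart_inv c (snd c y) = y"
    "C * dist (snd c x) (snd c y) \<le> e" if "y \<in> V" for y
    using that r(3) chart_inv_inverse(1)[OF c(1)] by (auto simp: V_def field_simps)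
  have x_in: "snd c x \<in> cball (snd c x) r" "chart_inv c (snd c x) = x"
    using r(1) chart_inv_inverse(1)[OF c(1)] c(2) by auto
  show ?thesis
  proof (rule that)
    show "openin X V" unfolding V_def by (rule openin_chart_preimage[OF c(1) open_ball])
    show "x \<in> V" using c(2) r(1,3) e by (simp add: V_def)
    fix y assume y: "y \<in> V"
    show "d p y \<le> d p x + ennreal e" for p
    proof -
      have "d p y \<le> d p x + ennreal (C * dist (snd c x) (snd c y))"
        using distance_segment_bounds(1)[OF c(1) convex_cball r(4) x_in(1) near(1)[OF y] C, of p] near(2)[OF y] x_in(2)
        by simp
      also have "\<dots> \<le> d p x + ennreal e" using near(3)[OF y] by (intro add_left_mono ennreal_leI)
      finally show ?thesis .
    qed
    show "d y q \<le> ennreal e + d x q" for q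
    proof -
      have "d y q \<le> ennreal (C * dist (snd c x) (snd c y)) + d x q"
        using distance_segment_bounds(2)[OF c(1) convex_cball r(4) near(1)[OF y] x_in(1) C, of q] near(2)[OF y] x_in(2)
        by (simp add: dist_commute)
      also have "\<dots> \<le> ennreal e + d x q" using near(3)[OF y] by (intro add_right_mono ennreal_leI)
      finally show ?thesis .
    qed
  qed
qed

text \<open>
  Upper semicontinuity of \<open>d\<close> is enough to make it measurable.
\<close>
lemma openin_distance_less:
  "openin (prod_topology X X) {(x, y). x \<in> topspace X \<and> y \<in> topspace X \<and> d x y < a}"
  unfolding openin_prod_topology_alt
proof (intro allI impI)
  fix x y assume "(x, y) \<in> {(x, y). x \<in> topspace X \<and> y \<in> topspace X \<and> d x y < a}"
  then have xy: "x \<in> topspace X" "y \<in> topspace X" "d x y < a" by auto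
  then have fin: "d x y < top" by (simp add: order_less_le_trans)
  then obtain m where m: "0 < m" "m < a - d x y"
    using dense[of 0 "a - d x y"] xy(3) by (auto simp: less_diff_eq_ennreal)
  obtain e where e: "m = ennreal e" "0 < e"
    using m by (cases m) auto
  have less: "d x y + ennreal e < a" using m(2) fin by (simp add: less_diff_eq_ennreal e(1) add.commute)
  obtain V where V: "openin X V" "x \<in> V" "\<And>z q. z \<in> V \<Longrightarrow> d z q \<le> ennreal (e / 2) + d x q"
    using small_distance_perturbation[OF xy(1), of "e / 2"] e(2) by (metis half_gt_zero)
  obtain W where W: "openin X W" "y \<in> W" "\<And>z p. z \<in> W \<Longrightarrow> d p z \<le> d p y + ennreal (e / 2)"
    using small_distance_perturbation[OF xy(2), of "e / 2"] e(2) by (metis half_gt_zero)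
  have "d x' y' < a" if "x' \<in> V" "y' \<in> W" for x' y'
  proof -
    have "d x' y' \<le> ennreal (e / 2) + (d x y + ennreal (e / 2))"
      using V(3)[OF that(1), of y'] W(3)[OF that(2), of x] by (meson add_left_mono order_trans)
    also have "\<dots> = d x y + (ennreal (e / 2) + ennreal (e / 2))" by (simp add: ac_simps)
    also have "\<dots> = d x y + ennreal e" using e(2) by (simp flip: ennreal_plus)
    finally show ?thesis using less by simp
  qed
  moreover have "V \<subseteq> topspace X" "W \<subseteq> topspace X" using V W openin_subset by blast+
  ultimately show "\<exists>V W. openin X V \<and> openin X W \<and> x \<in> V \<and> y \<in> W \<and>
      V \<times> W \<subseteq> {(x, y). x \<in> topspace X \<and> y \<in> topspace X \<and> d x y < a}"
    using V W by (intro exI[of _ V] exI[of _ W]) auto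
qed

section \<open>Spheres are null sets\<close>

lemma openin_riemannian_sublevel:
  assumes "p \<in> topspace X"
  shows "openin X {q \<in> topspace X. d p q < a}"
proof -
  have "continuous_map X (prod_topology X X) (\<lambda>q. (p, q))"
    using assms by (intro continuous_map_pairedI) auto
  from openin_continuous_map_preimage[OF this openin_distance_less[of a]]
  show ?thesis using assms by (simp add: conj_ac cong: conj_cong)
qed

lemma sets_borel_chart_sphere:
  assumes c: "c \<in> A" and p: "p \<in> topspace X"
  shows "{u \<in> snd c ` fst c. d p (chart_inv c u) = r} \<in> sets borel"
proof -
  let ?W = "snd c ` fst c"
  have W: "?W \<in> sets borel" using chart_homeomorphism(3)[OF c] by simp
  have "(\<lambda>u. d p (chart_inv c u)) \<in> borel_measurable (restrict_space borel ?W)"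
  proof (rule borel_measurableI_less)
    fix a
    have "open {u \<in> ?W. chart_inv c u \<in> {q \<in> topspace X. d p q < a}}"
      by (rule open_chart_image[OF c openin_riemannian_sublevel[OF p]])
    moreover have "chart_inv c u \<in> topspace X" if "u \<in> ?W" for u
      using chart_inv_inverse(3)[OF c that] chart_homeomorphism(2)[OF c] by blast
    ultimately have "open {u \<in> ?W. d p (chart_inv c u) < a}"
      by (simp cong: conj_cong)
    then show "{u \<in> space (restrict_space borel ?W). d p (chart_inv c u) < a} \<in> sets (restrict_space borel ?W)"
      using W by (simp add: sets_restrict_space_iff space_restrict_space)
  qed
  then have "{u \<in> space (restrict_space borel ?W). d p (chart_inv c u) = r} \<in> sets (restrict_space borel ?W)"
    by measurable
  then show ?thesis using W by (simp add: sets_restrict_space_iff space_restrict_space)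
qed

text \<open>
  Choose a curve from \<open>p\<close> to the point \<open>u\<close> of length less than \<open>t + \<kappa> R / 2\<close>. Its last part, inside the ball
  of radius \<open>R\<close>, costs at least \<open>\<kappa> R\<close>, so it enters this ball at a point \<open>w\<close> whose distance from \<open>p\<close> is less
  than \<open>t - \<kappa> R / 2\<close>. A segment from \<open>w\<close> of Riemannian length at most \<open>\<kappa> R / 2\<close> cannot make up for this.
\<close>
lemma hole_in_sphere:
  assumes c: "c \<in> A" and K: "convex K" "K \<subseteq> snd c ` fst c" and u: "u \<in> K" "cball u R \<subseteq> K"
    and \<kappa>: "\<kappa> > 0" "\<And>x w. x \<in> K \<Longrightarrow> \<kappa> * norm w \<le> sqrt (G c x w w)"
    and C: "C > 0" "\<And>x w. x \<in> K \<Longrightarrow> sqrt (G c x w w) \<le> C * norm w"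
    and R: "R > 0" and t: "t \<ge> 0" "d p (chart_inv c u) = ennreal t"
    and p: "\<not> (p \<in> fst c \<and> snd c p \<in> ball u R)"
  obtains w where "dist u w = R"
    "\<And>z. z \<in> K \<Longrightarrow> C * dist w z \<le> \<kappa> * R / 2 \<Longrightarrow> d p (chart_inv c z) < ennreal t"
proof -
  have uW: "u \<in> snd c ` fst c" using u(1) K(2) by blast
  note y = chart_inv_inverse(2,3)[OF c uW]
  have "d p (chart_inv c u) < ennreal (t + \<kappa> * R / 2)"
    using t \<kappa>(1) R by (simp add: ennreal_less_iff)
  then obtain \<gamma> a b where \<gamma>: "piecewise_C1_curve X A \<gamma> a b" "\<gamma> a = p" "\<gamma> b = chart_inv c u"
      and len: "curve_length A G \<gamma> a b < ennreal (t + \<kappa> * R / 2)"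
    by (rule distance_lessE)
  obtain s where s: "a \<le> s" "s \<le> b" "\<gamma> s \<in> fst c" "dist u (snd c (\<gamma> s)) = R"
    "ennreal (\<kappa> * R) \<le> curve_length A G \<gamma> s b"
    by (rule curve_enters_chart_ball[OF c y(2) K(2) _ \<kappa> \<gamma>(1,3) _ R]) (use y u(2) p \<gamma>(2) in auto)
  define w where "w = snd c (\<gamma> s)"
  have w: "w \<in> K" "chart_inv c w = \<gamma> s"
    using s(3,4) u(2) chart_inv_inverse(1)[OF c] by (auto simp: w_def)
  have "curve_length A G \<gamma> a s + ennreal (\<kappa> * R) \<le> curve_length A G \<gamma> a b"
    unfolding curve_length_split[OF \<gamma>(1) s(1,2)] using s(5) by (rule add_left_mono)
  also note len
  finally have L: "curve_length A G \<gamma> a s + ennreal (\<kappa> * R) < ennreal (t + \<kappa> * R / 2)" .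
  have early: "curve_length A G \<gamma> a s + ennreal (\<kappa> * R / 2) < ennreal t"
  proof (cases "curve_length A G \<gamma> a s")
    case (real l)
    have "0 \<le> \<kappa> * R" using \<kappa>(1) R by simp
    then have "l + \<kappa> * R < t + \<kappa> * R / 2"
      using L real t(1) by (simp add: ennreal_less_iff flip: ennreal_plus)
    then show ?thesis using real \<open>0 \<le> \<kappa> * R\<close> t(1) by (simp add: ennreal_less_iff flip: ennreal_plus)
  qed (use L in simp)
  have pw: "piecewise_C1_curve X A \<gamma> a s"
    by (rule piecewise_C1_subcurve[OF \<gamma>(1)]) (use s in auto)
  have "d p (chart_inv c z) < ennreal t" if z: "z \<in> K" "C * dist w z \<le> \<kappa> * R / 2" for z
  proof -
    obtain \<sigma> where \<sigma>: "piecewise_C1_curve X A \<sigma> s (s + 1)" "\<sigma> s = chart_inv c w" "\<sigma> (s + 1) = chart_inv c z"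
      "curve_length A G \<sigma> s (s + 1) \<le> ennreal (C * norm (z - w))"
      using segment_curve[OF c K w(1) z(1) C(2)] .
    have "d (\<gamma> a) (\<sigma> (s + 1)) \<le> curve_length A G \<gamma> a s + curve_length A G \<sigma> s (s + 1)"
      by (rule distance_le_concatenation[OF pw \<sigma>(1)]) (simp add: w(2) \<sigma>(2))
    also have "\<dots> \<le> curve_length A G \<gamma> a s + ennreal (\<kappa> * R / 2)"
    proof (rule add_left_mono)
      have "ennreal (C * norm (z - w)) \<le> ennreal (\<kappa> * R / 2)"
        using z(2) by (intro ennreal_leI) (simp add: dist_norm norm_minus_commute)
      with \<sigma>(4) show "curve_length A G \<sigma> s (s + 1) \<le> ennreal (\<kappa> * R / 2)" by (rule order_trans)
    qed
    also note early
    finally show ?thesis by (simp add: \<gamma>(2) \<sigma>(3))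
  qed
  moreover have "dist u w = R" using s(4) by (simp add: w_def)
  ultimately show ?thesis by (intro that[of w])
qed

text \<open>
  Around each point the comparison constants \<open>\<kappa>\<close> and \<open>C\<close> can be chosen uniformly, so the sphere is locally
  porous with a fixed ratio \<open>k\<close>. The centre \<open>p\<close>, which lies on the sphere for \<open>t = 0\<close>, is
  removed, because the balls that are used must not contain \<open>p\<close>.
\<close>
lemma negligible_chart_sphere:
  assumes c: "c \<in> A" and p: "p \<in> topspace X" and t: "t \<ge> 0"
  shows "negligible {u \<in> snd c ` fst c. d p (chart_inv c u) = ennreal t}" (is "negligible ?S")
proof (rule locally_negligible_alt[THEN iffD2], rule ballI)
  fix u0 assume "u0 \<in> ?S"
  then have u0: "u0 \<in> snd c ` fst c" by simp
  obtain r \<kappa> C where r: "0 < r" "0 < \<kappa>" "0 < C" "cball u0 r \<subseteq> snd c ` fst c"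
    and bounds: "\<forall>z\<in>cball u0 r. \<forall>w. \<kappa> * norm w \<le> sqrt (G c z w w) \<and> sqrt (G c z w w) \<le> C * norm w"
    using chart_constants[OF c u0] .
  define S where "S = (?S \<inter> ball u0 (r / 2)) - {snd c p}"
  \<comment> \<open>With \<open>R = \<rho> / 2\<close> below, the hole of radius \<open>k \<rho>\<close> stays in the ball of radius \<open>\<rho>\<close>, and \<open>C k \<rho> \<le> \<kappa> R / 2\<close>.\<close>
  define k where "k = min (1/2) (\<kappa> / (4 * C))"
  have k: "0 < k" "k \<le> 1/2" "C * k \<le> \<kappa> / 4" using r by (auto simp: k_def min_def field_simps)
  have "negligible S"
  proof (rule porous_imp_negligible[OF _ k(1)])
    show "S \<in> sets lebesgue"
      unfolding S_def using sets_borel_chart_sphere[OF c p, of "ennreal t"]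
      by (intro sets.Diff sets.Int) auto
    fix u assume "u \<in> S"
    then have u: "u \<in> ball u0 (r / 2)" "u \<noteq> snd c p" "d p (chart_inv c u) = ennreal t"
      by (auto simp: S_def)
    show "\<exists>r0>0. \<forall>\<rho>. 0 < \<rho> \<and> \<rho> < r0 \<longrightarrow> (\<exists>y. ball y (k * \<rho>) \<subseteq> ball u \<rho> \<and> ball y (k * \<rho>) \<inter> S = {})"
    proof (intro exI[of _ "min (r / 2) (dist (snd c p) u)"] conjI allI impI)
      show "0 < min (r / 2) (dist (snd c p) u)" using r u(2) by simp
      fix \<rho> assume \<rho>: "0 < \<rho> \<and> \<rho> < min (r / 2) (dist (snd c p) u)"
      have sub: "cball u \<rho> \<subseteq> cball u0 r"
      proof
        fix z assume "z \<in> cball u \<rho>"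
        then show "z \<in> cball u0 r" using dist_triangle[of u0 z u] u(1) \<rho> by simp
      qed
      have uK: "u \<in> cball u0 r" "cball u (\<rho> / 2) \<subseteq> cball u0 r"
        using subsetD[OF sub, of u] \<rho> by simp (rule order_trans[OF subset_cball sub], use \<rho> in simp)
      have out: "\<not> (p \<in> fst c \<and> snd c p \<in> ball u (\<rho> / 2))" using \<rho> by (auto simp: dist_commute)
      obtain y where y: "dist u y = \<rho> / 2"
        "\<And>z. z \<in> cball u0 r \<Longrightarrow> C * dist y z \<le> \<kappa> * (\<rho> / 2) / 2 \<Longrightarrow> d p (chart_inv c z) < ennreal t"
        by (rule hole_in_sphere[OF c convex_cball r(4) uK r(2) _ r(3) _ _ t u(3) out])
          (use bounds \<rho> in auto)
      have hole: "ball y (k * \<rho>) \<subseteq> ball u \<rho>"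
      proof
        fix z assume "z \<in> ball y (k * \<rho>)"
        then have "dist u z < \<rho> / 2 + k * \<rho>" using dist_triangle[of u z y] y(1) by simp
        also have "\<dots> \<le> \<rho> / 2 + 1/2 * \<rho>" using k(2) \<rho> by (intro add_left_mono mult_right_mono) auto
        finally show "z \<in> ball u \<rho>" by simp
      qed
      have "z \<notin> S" if z: "z \<in> ball y (k * \<rho>)" for z
      proof -
        have "z \<in> cball u0 r" using subsetD[OF sub, of z] subsetD[OF hole z] by simp
        moreover have "C * dist y z \<le> C * (k * \<rho>)" using z r(3) by (intro mult_left_mono) auto
        moreover have "C * (k * \<rho>) \<le> \<kappa> / 4 * \<rho>"
          using mult_right_mono[OF k(3), of \<rho>] \<rho> by (simp add: mult.assoc)
        ultimately have "d p (chart_inv c z) < ennreal t" by (intro y(2)) auto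
        then show ?thesis unfolding S_def by (intro notI) simp
      qed
      then show "\<exists>y. ball y (k * \<rho>) \<subseteq> ball u \<rho> \<and> ball y (k * \<rho>) \<inter> S = {}"
        using hole by (intro exI[of _ y]) blast
    qed
  qed
  then have "negligible (insert (snd c p) S)" by simp
  then have "negligible (?S \<inter> ball u0 (r / 2))" by (rule negligible_subset) (auto simp: S_def)
  moreover have "openin (top_of_set ?S) (?S \<inter> ball u0 (r / 2))" by (intro openin_open_Int) simp
  moreover have "u0 \<in> ?S \<inter> ball u0 (r / 2)" using \<open>u0 \<in> ?S\<close> r(1) by simp
  ultimately show "\<exists>U. openin (top_of_set ?S) U \<and> u0 \<in> U \<and> negligible U" by blast
qed

end

text \<open>
  Whichever pieces and charts compute the integral, each
  piece has a Lebesgue null image in its chart.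
\<close>
lemma induced_measure_eq_0:
  assumes \<mu>: "induced_measure X Ori w \<mu>" and E: "E \<in> borel_sets X"
    and null: "\<And>c. c \<in> Ori \<Longrightarrow> negligible (snd c ` (fst c \<inter> E))"
  shows "emeasure \<mu> E = 0"
proof -
  have "has_form_integral X Ori w E (emeasure \<mu> E)"
    using \<mu> E by (simp add: induced_measure_def)
  then obtain c B where cB: "\<forall>i::nat. c i \<in> Ori \<and> B i \<in> borel_sets X \<and> B i \<subseteq> fst (c i)"
    and B: "(\<Union>i. B i) = E"
    and eq: "emeasure \<mu> E = (\<Sum>i. \<integral>\<^sup>+x\<in>snd (c i) ` B i. ennreal (w (c i) x) \<partial>lborel)"
    unfolding has_form_integral_def by (elim exE conjE)
  have "(\<integral>\<^sup>+x\<in>snd (c i) ` B i. ennreal (w (c i) x) \<partial>lborel) = 0" for i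
  proof -
    have ci: "c i \<in> Ori" "B i \<subseteq> fst (c i) \<inter> E" using cB B by blast+
    have "negligible (snd (c i) ` B i)"
      by (rule negligible_subset[OF null[OF ci(1)] image_mono[OF ci(2)]])
    then have "AE x in lebesgue. x \<notin> snd (c i) ` B i"
      by (simp add: negligible_iff_null_sets AE_not_in)
    then have "AE x in lborel. x \<notin> snd (c i) ` B i" by (simp add: AE_completion_iff)
    then have "AE x in lborel. ennreal (w (c i) x) * indicator (snd (c i) ` B i) x = 0"
      by eventually_elim auto
    then show ?thesis by (subst nn_integral_cong_AE) auto
  qed
  then show ?thesis by (simp add: eq)
qed

section \<open>Vietoris-Rips complexes of finite samples\<close>

text \<open>
  A relabelling of the vertices transports barycentric coordinates, extended by zero; in the
  topology of pointwise convergence, continuity is a matter of single coordinates.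
\<close>
lemma homeomorphic_geometric_realization:
  fixes h :: "'v \<Rightarrow> 'w"
  assumes inj: "inj_on h V" and K: "\<Union>K \<subseteq> V"
  shows "geometric_realization K homeomorphic_space geometric_realization ((`) h ` K)"
proof -
  define push :: "('v \<Rightarrow> real) \<Rightarrow> 'w \<Rightarrow> real"
    where "push \<alpha> w = (if w \<in> h ` V then \<alpha> (inv_into V h w) else 0)" for \<alpha> w
  define pull :: "('w \<Rightarrow> real) \<Rightarrow> 'v \<Rightarrow> real"
    where "pull \<beta> v = (if v \<in> V then \<beta> (h v) else 0)" for \<beta> v
  let ?R = "\<lambda>K. {\<alpha>. (\<forall>v. \<alpha> v \<ge> 0) \<and> {v. \<alpha> v \<noteq> 0} \<in> K \<and> (\<Sum>v | \<alpha> v \<noteq> 0. \<alpha> v) = 1}"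
  have push_h: "push \<alpha> (h v) = \<alpha> v" if "v \<in> V" for \<alpha> v
    using that inj by (simp add: push_def)
  have supp_V: "{v. \<alpha> v \<noteq> 0} \<subseteq> V" if "{v. \<alpha> v \<noteq> 0} \<in> K" for \<alpha> :: "'v \<Rightarrow> real"
    using that K by blast
  have supp_push: "{w. push \<alpha> w \<noteq> 0} = h ` {v. \<alpha> v \<noteq> 0}" if "{v. \<alpha> v \<noteq> 0} \<subseteq> V" for \<alpha>
  proof -
    have "w \<in> h ` {v. \<alpha> v \<noteq> 0}" if "push \<alpha> w \<noteq> 0" for w
    proof -
      have w: "w \<in> h ` V" "\<alpha> (inv_into V h w) \<noteq> 0" using that by (auto simp: push_def split: if_splits)
      then show ?thesis by (intro image_eqI[of _ _ "inv_into V h w"]) (auto simp: f_inv_into_f)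
    qed
    moreover have "push \<alpha> (h v) \<noteq> 0" if "\<alpha> v \<noteq> 0" for v
      using that push_h \<open>{v. \<alpha> v \<noteq> 0} \<subseteq> V\<close> by auto
    ultimately show ?thesis by blast
  qed
  have push_R: "push \<alpha> \<in> ?R ((`) h ` K)" if \<alpha>: "\<alpha> \<in> ?R K" for \<alpha>
  proof -
    have V: "{v. \<alpha> v \<noteq> 0} \<subseteq> V" using \<alpha> by (intro supp_V) simp
    have "(\<Sum>w | push \<alpha> w \<noteq> 0. push \<alpha> w) = (\<Sum>v | \<alpha> v \<noteq> 0. push \<alpha> (h v))"
      unfolding supp_push[OF V] using inj_on_subset[OF inj V] by (simp add: sum.reindex)
    also have "\<dots> = (\<Sum>v | \<alpha> v \<noteq> 0. \<alpha> v)" using V push_h by (intro sum.cong) auto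
    finally have "(\<Sum>w | push \<alpha> w \<noteq> 0. push \<alpha> w) = 1" using \<alpha> by simp
    moreover have "{w. push \<alpha> w \<noteq> 0} \<in> (`) h ` K" unfolding supp_push[OF V] using \<alpha> by blast
    moreover have "push \<alpha> w \<ge> 0" for w using \<alpha> by (simp add: push_def)
    ultimately show ?thesis by blast
  qed
  have pull_push: "pull (push \<alpha>) = \<alpha>" if "\<alpha> \<in> ?R K" for \<alpha>
  proof
    fix v
    have "\<alpha> v = 0" if "v \<notin> V" using supp_V[of \<alpha>] \<open>\<alpha> \<in> ?R K\<close> that by blast
    then show "pull (push \<alpha>) v = \<alpha> v" by (simp add: pull_def push_h)
  qed
  have pull_R: "pull \<beta> \<in> ?R K \<and> push (pull \<beta>) = \<beta>" if \<beta>: "\<beta> \<in> ?R ((`) h ` K)" for \<beta>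
  proof -
    obtain \<tau> where \<tau>: "\<tau> \<in> K" "{w. \<beta> w \<noteq> 0} = h ` \<tau>" using \<beta> by auto
    have \<tau>V: "\<tau> \<subseteq> V" using \<tau>(1) K by blast
    have supp: "{v. pull \<beta> v \<noteq> 0} = \<tau>"
    proof
      show "{v. pull \<beta> v \<noteq> 0} \<subseteq> \<tau>"
      proof
        fix v assume "v \<in> {v. pull \<beta> v \<noteq> 0}"
        then have v: "v \<in> V" "h v \<in> h ` \<tau>" using \<tau>(2) by (auto simp: pull_def split: if_splits)
        then show "v \<in> \<tau>" using inj \<tau>V by (simp add: inj_on_image_mem_iff)
      qed
      show "\<tau> \<subseteq> {v. pull \<beta> v \<noteq> 0}" using \<tau>(2) \<tau>V by (auto simp: pull_def)
    qed
    have "(\<Sum>v | pull \<beta> v \<noteq> 0. pull \<beta> v) = (\<Sum>v\<in>\<tau>. \<beta> (h v))"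
      unfolding supp using \<tau>V by (intro sum.cong) (auto simp: pull_def)
    also have "\<dots> = (\<Sum>w | \<beta> w \<noteq> 0. \<beta> w)"
      unfolding \<tau>(2) using inj_on_subset[OF inj \<tau>V] by (simp add: sum.reindex)
    also have "\<dots> = 1" using \<beta> by simp
    finally have "pull \<beta> \<in> ?R K" using \<beta> supp \<tau>(1) by (simp add: pull_def)
    moreover have "push (pull \<beta>) w = \<beta> w" for w
    proof (cases "w \<in> h ` V")
      case True
      then show ?thesis by (auto simp: push_h) (simp add: pull_def)
    next
      case False
      then have "\<beta> w = 0" using \<tau>(2) \<tau>V by blast
      then show ?thesis using False by (simp add: push_def)
    qed
    ultimately show ?thesis by blast
  qed
  have "homeomorphic_maps (geometric_realization K) (geometric_realization ((`) h ` K)) push pull"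
    unfolding homeomorphic_maps_def
  proof (intro conjI ballI)
    have coord: "continuous_map (geometric_realization L) euclideanreal (\<lambda>\<alpha>. \<alpha> v)" for L :: "'b set set" and v
      unfolding geometric_realization_def
      by (intro continuous_map_from_subtopology continuous_map_product_projection) simp
    have top: "topspace (geometric_realization L) = ?R L" for L :: "'b set set"
      by (simp add: geometric_realization_def)
    show "continuous_map (geometric_realization K) (geometric_realization ((`) h ` K)) push"
      unfolding geometric_realization_def[of "(`) h ` K"]
    proof (rule continuous_map_into_subtopology)
      show "push \<in> topspace (geometric_realization K) \<rightarrow> ?R ((`) h ` K)" unfolding top by (intro Pi_I push_R)
      have "continuous_map (geometric_realization K) euclideanreal (\<lambda>\<alpha>. push \<alpha> w)" for w
        unfolding push_def by (cases "w \<in> h ` V") (simp_all add: coord)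
      then show "continuous_map (geometric_realization K) (powertop_real UNIV) push"
        by (simp add: continuous_map_componentwise_UNIV)
    qed
    show "continuous_map (geometric_realization ((`) h ` K)) (geometric_realization K) pull"
      unfolding geometric_realization_def[of K]
    proof (rule continuous_map_into_subtopology)
      show "pull \<in> topspace (geometric_realization ((`) h ` K)) \<rightarrow> ?R K" unfolding top by (intro Pi_I) (use pull_R in blast)
      have "continuous_map (geometric_realization ((`) h ` K)) euclideanreal (\<lambda>\<alpha>. pull \<alpha> w)" for w
        unfolding pull_def by (cases "w \<in> V") (simp_all add: coord)
      then show "continuous_map (geometric_realization ((`) h ` K)) (powertop_real UNIV) pull"
        by (simp add: continuous_map_componentwise_UNIV)
    qed
    show "pull (push \<alpha>) = \<alpha>" if "\<alpha> \<in> topspace (geometric_realization K)" for \<alpha>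
      using that unfolding top by (rule pull_push)
    show "push (pull \<beta>) = \<beta>" if "\<beta> \<in> topspace (geometric_realization ((`) h ` K))" for \<beta>
      using pull_R[of \<beta>] that unfolding top by simp
  qed
  then show ?thesis unfolding homeomorphic_space_def by blast
qed

lemma diam_le_iff: "diam d \<sigma> \<le> r \<longleftrightarrow> (\<forall>x\<in>\<sigma>. \<forall>y\<in>\<sigma>. d x y \<le> r)"
  by (simp add: diam_def SUP_le_iff)

lemma finite_simplicial_complex_vietoris_rips:
  assumes "finite P"
  shows "finite_simplicial_complex (vietoris_rips d P t)" "card (vietoris_rips d P t) \<le> 2 ^ card P"
proof -
  have sub: "vietoris_rips d P t \<subseteq> Pow P" by (auto simp: vietoris_rips_def)
  then have fin: "finite (vietoris_rips d P t)" using assms finite_subset by blast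
  show "finite_simplicial_complex (vietoris_rips d P t)"
    unfolding finite_simplicial_complex_def
  proof (intro conjI ballI allI impI fin)
    fix \<sigma> assume \<sigma>: "\<sigma> \<in> vietoris_rips d P t"
    then show "finite \<sigma>" "\<sigma> \<noteq> {}" using assms by (auto simp: vietoris_rips_def intro: finite_subset)
    fix \<tau> assume "\<tau> \<subseteq> \<sigma> \<and> \<tau> \<noteq> {}"
    then show "\<tau> \<in> vietoris_rips d P t" using \<sigma> by (auto simp: vietoris_rips_def diam_le_iff)
  qed
  show "card (vietoris_rips d P t) \<le> 2 ^ card P"
    using card_mono[OF _ sub] assms by (simp add: card_Pow)
qed

lemma vietoris_rips_eqI:
  assumes "\<And>x y. x \<in> P \<Longrightarrow> y \<in> P \<Longrightarrow> d x y \<le> ennreal s \<longleftrightarrow> d x y \<le> ennreal t"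
  shows "vietoris_rips d P s = vietoris_rips d P t"
  unfolding vietoris_rips_def diam_le_iff using assms by blast

text \<open>
  The combinatorial data of a sample that determine its Vietoris-Rips complex up to isomorphism.
  Coincidences of points are recorded because they change the number of vertices.
\<close>
definition sample_pattern ::
    "('a \<Rightarrow> 'a \<Rightarrow> ennreal) \<Rightarrow> nat \<Rightarrow> real \<Rightarrow> (nat \<Rightarrow> 'a) \<Rightarrow> (nat \<times> nat) set \<times> (nat \<times> nat) set" where
  "sample_pattern d n t x =
     ({(i, j). i < n \<and> j < n \<and> x i = x j}, {(i, j). i < n \<and> j < n \<and> d (x i) (x j) \<le> ennreal t})"

text \<open>
  Equal patterns make \<open>x i \<mapsto> y i\<close> a well-defined bijection of the vertex sets that preserves the
  relation of being within distance \<open>t\<close>, hence an isomorphism of complexes.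
\<close>
lemma invariant_vietoris_rips_sample_pattern:
  fixes x y :: "nat \<Rightarrow> 'a"
  assumes T: "topological_invariant T" and eq: "sample_pattern d n t x = sample_pattern d n t y"
  shows "T (vietoris_rips d (x ` {..<n}) t) = T (vietoris_rips d (y ` {..<n}) t)"
proof -
  have same: "x i = x j \<longleftrightarrow> y i = y j" "d (x i) (x j) \<le> ennreal t \<longleftrightarrow> d (y i) (y j) \<le> ennreal t"
    if "i < n" "j < n" for i j
    using eq that unfolding sample_pattern_def by blast+
  define h where "h p = y (SOME i. i < n \<and> x i = p)" for p
  have h: "h (x i) = y i" if "i < n" for i
  proof -
    have "(SOME j. j < n \<and> x j = x i) < n \<and> x (SOME j. j < n \<and> x j = x i) = x i"
      using that by (intro someI[of "\<lambda>j. j < n \<and> x j = x i" i]) simp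
    then show ?thesis using same(1) that unfolding h_def by blast
  qed
  have inj: "inj_on h (x ` {..<n})"
    by (rule inj_onI) (use h same(1) in auto)
  have img: "h ` x ` {..<n} = y ` {..<n}" using h by (force simp: image_image)
  have dh: "d (h p) (h q) \<le> ennreal t \<longleftrightarrow> d p q \<le> ennreal t" if "p \<in> x ` {..<n}" "q \<in> x ` {..<n}" for p q
    using that same(2) h by auto
  have "vietoris_rips d (y ` {..<n}) t = (`) h ` vietoris_rips d (x ` {..<n}) t"
  proof (intro equalityI subsetI)
    fix \<tau> assume \<tau>: "\<tau> \<in> vietoris_rips d (y ` {..<n}) t"
    then have \<tau>': "\<tau> \<subseteq> h ` x ` {..<n}" "\<tau> \<noteq> {}" "\<forall>p\<in>\<tau>. \<forall>q\<in>\<tau>. d p q \<le> ennreal t"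
      unfolding vietoris_rips_def diam_le_iff img by simp_all
    obtain \<sigma> where \<sigma>: "\<sigma> \<subseteq> x ` {..<n}" "\<tau> = h ` \<sigma>" using subset_imageE[OF \<tau>'(1)] .
    have "d p q \<le> ennreal t" if "p \<in> \<sigma>" "q \<in> \<sigma>" for p q
      using dh[of p q] \<tau>'(3) \<sigma> that by blast
    moreover have "\<sigma> \<noteq> {}" using \<tau>'(2) \<sigma>(2) by blast
    ultimately have "\<sigma> \<in> vietoris_rips d (x ` {..<n}) t"
      using \<sigma>(1) by (simp add: vietoris_rips_def diam_le_iff)
    then show "\<tau> \<in> (`) h ` vietoris_rips d (x ` {..<n}) t" using \<sigma>(2) by blast
  next
    fix \<tau> assume "\<tau> \<in> (`) h ` vietoris_rips d (x ` {..<n}) t"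
    then obtain \<sigma> where \<sigma>: "\<sigma> \<subseteq> x ` {..<n}" "\<sigma> \<noteq> {}" "\<forall>p\<in>\<sigma>. \<forall>q\<in>\<sigma>. d p q \<le> ennreal t" "\<tau> = h ` \<sigma>"
      unfolding vietoris_rips_def diam_le_iff by blast
    have "\<tau> \<subseteq> y ` {..<n}" unfolding img[symmetric] \<sigma>(4) using \<sigma>(1) by (rule image_mono)
    moreover have "\<forall>p\<in>\<tau>. \<forall>q\<in>\<tau>. d p q \<le> ennreal t" unfolding \<sigma>(4) using \<sigma>(1,3) dh by (simp add: subset_iff)
    ultimately show "\<tau> \<in> vietoris_rips d (y ` {..<n}) t"
      using \<sigma>(2,4) by (simp add: vietoris_rips_def diam_le_iff)
  qed
  moreover have "\<Union> (vietoris_rips d (x ` {..<n}) t) \<subseteq> x ` {..<n}" by (auto simp: vietoris_rips_def)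
  ultimately have "geometric_realization (vietoris_rips d (x ` {..<n}) t) homeomorphic_space
      geometric_realization (vietoris_rips d (y ` {..<n}) t)"
    using homeomorphic_geometric_realization[OF inj] by metis
  then show ?thesis
    using T finite_simplicial_complex_vietoris_rips(1)[of "x ` {..<n}"]
      finite_simplicial_complex_vietoris_rips(1)[of "y ` {..<n}"]
    unfolding topological_invariant_def by blast
qed

text \<open>
  The random variable factors through the pattern of the sample, which takes finitely many values.
\<close>
lemma borel_measurable_invariant_vietoris_rips:
  fixes M :: "(nat \<Rightarrow> 'a) measure"
  assumes T: "topological_invariant T"
    and eqs: "\<And>i j. i < n \<Longrightarrow> j < n \<Longrightarrow> {x \<in> space M. x i = x j} \<in> sets M"
    and dist: "\<And>i j. i < n \<Longrightarrow> j < n \<Longrightarrow> {x \<in> space M. d (x i) (x j) \<le> ennreal t} \<in> sets M"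
  shows "(\<lambda>x. T (vietoris_rips d (x ` {..<n}) t)) \<in> borel_measurable M"
proof -
  let ?TX = "\<lambda>x. T (vietoris_rips d (x ` {..<n}) t)"
  let ?F = "Pow ({..<n} \<times> {..<n}) \<times> Pow ({..<n} \<times> {..<n})"
  have eqs': "{x \<in> space M. P = (x i = x j)} \<in> sets M" if "i < n" "j < n" for P i j
    using eqs[OF that] by (cases P) (auto intro: sets.sets_Collect_neg)
  have dist': "{x \<in> space M. P = (d (x i) (x j) \<le> ennreal t)} \<in> sets M" if "i < n" "j < n" for P i j
    using dist[OF that] by (cases P) (auto simp: not_le[symmetric] intro: sets.sets_Collect_neg)
  have "finite ?F" by simp
  have "sample_pattern d n t \<in> measurable M (count_space ?F)"
    unfolding measurable_count_space_eq2[OF \<open>finite ?F\<close>]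
  proof (intro conjI ballI)
    show "sample_pattern d n t \<in> space M \<rightarrow> ?F" by (auto simp: sample_pattern_def)
    fix a assume "a \<in> ?F"
    then obtain P Q where a: "a = (P, Q)" "P \<subseteq> {..<n} \<times> {..<n}" "Q \<subseteq> {..<n} \<times> {..<n}" by blast
    have set_eq: "{(i, j). i < n \<and> j < n \<and> \<phi> i j} = R \<longleftrightarrow> (\<forall>i\<in>{..<n}. \<forall>j\<in>{..<n}. ((i, j) \<in> R) = \<phi> i j)"
      if "R \<subseteq> {..<n} \<times> {..<n}" for R and \<phi> :: "nat \<Rightarrow> nat \<Rightarrow> bool"
      using that by auto
    have "sample_pattern d n t x = a \<longleftrightarrow> (\<forall>i\<in>{..<n}. \<forall>j\<in>{..<n}. ((i, j) \<in> P) = (x i = x j)) \<and>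
        (\<forall>i\<in>{..<n}. \<forall>j\<in>{..<n}. ((i, j) \<in> Q) = (d (x i) (x j) \<le> ennreal t))" for x
      unfolding sample_pattern_def a(1) prod.inject set_eq[OF a(2)] set_eq[OF a(3)] ..
    then have "sample_pattern d n t -` {a} \<inter> space M = {x \<in> space M. (\<forall>i\<in>{..<n}. \<forall>j\<in>{..<n}. ((i, j) \<in> P) = (x i = x j)) \<and>
        (\<forall>i\<in>{..<n}. \<forall>j\<in>{..<n}. ((i, j) \<in> Q) = (d (x i) (x j) \<le> ennreal t))}"
      by (simp add: vimage_def Int_def conj_ac)
    also have "\<dots> \<in> sets M"
      by (intro sets.sets_Collect_conj sets.sets_Collect_finite_All eqs' dist') auto
    finally show "sample_pattern d n t -` {a} \<inter> space M \<in> sets M" .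
  qed
  moreover define g where "g a = ?TX (SOME x. x \<in> space M \<and> sample_pattern d n t x = a)" for a
  have "g \<in> measurable (count_space ?F) borel" by simp
  ultimately have "(\<lambda>x. g (sample_pattern d n t x)) \<in> borel_measurable M" by (rule measurable_compose)
  moreover have "g (sample_pattern d n t x) = ?TX x" if "x \<in> space M" for x
  proof -
    have "sample_pattern d n t (SOME y. y \<in> space M \<and> sample_pattern d n t y = sample_pattern d n t x) = sample_pattern d n t x"
      using someI[of "\<lambda>y. y \<in> space M \<and> sample_pattern d n t y = sample_pattern d n t x" x] that by blast
    then show ?thesis unfolding g_def by (rule invariant_vietoris_rips_sample_pattern[OF T])
  qed
  ultimately show ?thesis by (simp cong: measurable_cong)
qed

section \<open>Independent samples from an induced probability measure\<close>

text \<open>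
  An open set in the product is a countable union of rectangles from a countable base.
\<close>
lemma openin_prod_in_sets_pair_measure:
  assumes X: "second_countable X" and \<mu>: "sets \<mu> = borel_sets X"
    and W: "openin (prod_topology X X) W"
  shows "W \<in> sets (\<mu> \<Otimes>\<^sub>M \<mu>)"
proof -
  obtain B where B: "countable B" "\<And>V. V \<in> B \<Longrightarrow> openin X V"
    and base: "\<And>U x. openin X U \<Longrightarrow> x \<in> U \<Longrightarrow> \<exists>V\<in>B. x \<in> V \<and> V \<subseteq> U"
    using X unfolding second_countable_def by metis
  define R where "R = {P \<in> B \<times> B. fst P \<times> snd P \<subseteq> W}"
  have "W \<subseteq> (\<Union>P\<in>R. fst P \<times> snd P)"
  proof
    fix z assume z: "z \<in> W"
    obtain x y where xy: "z = (x, y)" by (cases z)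
    obtain U V where UV: "openin X U" "openin X V" "x \<in> U" "y \<in> V" "U \<times> V \<subseteq> W"
      using W[unfolded openin_prod_topology_alt, rule_format, OF z[unfolded xy]] by (elim exE conjE)
    obtain U' V' where "U' \<in> B" "x \<in> U'" "U' \<subseteq> U" "V' \<in> B" "y \<in> V'" "V' \<subseteq> V"
      using base[OF UV(1,3)] base[OF UV(2,4)] by (elim bexE conjE)
    then show "z \<in> (\<Union>P\<in>R. fst P \<times> snd P)"
      using UV(5) by (intro UN_I[of "(U', V')"]) (auto simp: R_def xy)
  qed
  moreover have "(\<Union>P\<in>R. fst P \<times> snd P) \<subseteq> W" by (rule UN_least) (simp add: R_def)
  ultimately have W_eq: "W = (\<Union>P\<in>R. fst P \<times> snd P)" by (rule equalityI)
  have "countable R"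
    by (rule countable_subset[of _ "B \<times> B"]) (auto simp: R_def B(1))
  moreover have "fst P \<times> snd P \<in> sets (\<mu> \<Otimes>\<^sub>M \<mu>)" if "P \<in> R" for P
  proof -
    have "openin X (fst P)" "openin X (snd P)" using that B(2) by (auto simp: R_def)
    then show ?thesis unfolding \<mu> borel_sets_def
      by (intro pair_measureI) (auto simp: \<mu> borel_sets_def intro: sigma_sets.Basic)
  qed
  ultimately show ?thesis unfolding W_eq by (rule sets.countable_UN'')
qed

text \<open>
  Fubini with the coordinate \<open>j\<close> integrated first while \<open>x i\<close> is fixed. For \<open>B = 0\<close> this transfers null
  sets; for spherical shells it gives the quantitative bound.
\<close>
lemma emeasure_PiM_pair_le:
  fixes n :: nat
  assumes "prob_space \<mu>" and ij: "i < n" "j < n" "i \<noteq> j" and W: "W \<in> sets (\<mu> \<Otimes>\<^sub>M \<mu>)"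
    and bound: "\<And>x. x \<in> space \<mu> \<Longrightarrow> emeasure \<mu> (Pair x -` W) \<le> B"
  shows "emeasure (Pi\<^sub>M {..<n} (\<lambda>_. \<mu>)) {x \<in> space (Pi\<^sub>M {..<n} (\<lambda>_. \<mu>)). (x i, x j) \<in> W} \<le> B"
proof -
  interpret \<mu>: prob_space \<mu> by fact
  interpret P: product_sigma_finite "\<lambda>_::nat. \<mu>" ..
  define I where "I = {..<n} - {j}"
  have I: "finite I" "j \<notin> I" "i \<in> I" "{..<n} = insert j I" using ij by (auto simp: I_def)
  let ?M = "Pi\<^sub>M (insert j I) (\<lambda>_. \<mu>)"
  have pair: "(\<lambda>x. (x i, x j)) \<in> measurable ?M (\<mu> \<Otimes>\<^sub>M \<mu>)" 
    using I(3) by (intro measurable_Pair measurable_component_singleton) auto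
  have "emeasure ?M {x \<in> space ?M. (x i, x j) \<in> W} = (\<integral>\<^sup>+x. indicator W (x i, x j) \<partial>?M)"
  proof -
    have "{x \<in> space ?M. (x i, x j) \<in> W} \<in> sets ?M"
      using measurable_sets[OF pair W] by (simp add: vimage_def Int_def conj_commute)
    then have "emeasure ?M {x \<in> space ?M. (x i, x j) \<in> W} =
        (\<integral>\<^sup>+x. indicator {x \<in> space ?M. (x i, x j) \<in> W} x \<partial>?M)"
      by (simp only: nn_integral_indicator)
    also have "\<dots> = (\<integral>\<^sup>+x. indicator W (x i, x j) \<partial>?M)"
      by (intro nn_integral_cong) (simp add: indicator_def)
    finally show ?thesis .
  qed
  also have "\<dots> = (\<integral>\<^sup>+x. (\<integral>\<^sup>+y. indicator W ((x(j := y)) i, (x(j := y)) j) \<partial>\<mu>) \<partial>Pi\<^sub>M I (\<lambda>_. \<mu>))"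
    using measurable_compose[OF pair borel_measurable_indicator[OF W]]
    by (intro P.product_nn_integral_insert[OF I(1,2)])
  also have "\<dots> = (\<integral>\<^sup>+x. emeasure \<mu> (Pair (x i) -` W) \<partial>Pi\<^sub>M I (\<lambda>_. \<mu>))"
  proof (rule nn_integral_cong)
    fix x
    have "(\<integral>\<^sup>+y. indicator W ((x(j := y)) i, (x(j := y)) j) \<partial>\<mu>) = (\<integral>\<^sup>+y. indicator (Pair (x i) -` W) y \<partial>\<mu>)"
      using ij(3) by (intro nn_integral_cong) (simp add: indicator_def)
    then show "(\<integral>\<^sup>+y. indicator W ((x(j := y)) i, (x(j := y)) j) \<partial>\<mu>) = emeasure \<mu> (Pair (x i) -` W)"
      using sets_Pair1[OF W] by simp
  qed
  also have "\<dots> \<le> (\<integral>\<^sup>+x. B \<partial>Pi\<^sub>M I (\<lambda>_. \<mu>))"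
    using I(3) by (intro nn_integral_mono bound) (auto simp: space_PiM)
  also have "\<dots> = B"
  proof -
    interpret PI: prob_space "Pi\<^sub>M I (\<lambda>_. \<mu>)" by (rule prob_space_PiM[OF assms(1)])
    show ?thesis by (simp add: PI.emeasure_space_1)
  qed
  finally show ?thesis by (simp only: I(4))
qed

locale induced_probability = riemannian_structure X A G + prob_space \<mu>
  for X :: "'a topology" and A :: "('a, 'n::finite) chart set" and G and \<mu> :: "'a measure" +
  fixes Ori :: "('a, 'n) chart set" and w :: "('a, 'n) top_form"
  assumes oriented_charts: "Ori \<subseteq> A" and induced: "induced_measure X Ori w \<mu>"
begin

lemma space_\<mu>: "space \<mu> = topspace X" and sets_\<mu>: "sets \<mu> = borel_sets X"
  using induced by (simp_all add: induced_measure_def)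

lemma space_pair: "space (\<mu> \<Otimes>\<^sub>M \<mu>) = topspace X \<times> topspace X"
  by (simp add: space_pair_measure space_\<mu>)

lemma measurable_distance_pair [measurable]: "(\<lambda>(x, y). d x y) \<in> borel_measurable (\<mu> \<Otimes>\<^sub>M \<mu>)"
proof (rule borel_measurableI_less)
  fix a
  have "{z \<in> space (\<mu> \<Otimes>\<^sub>M \<mu>). (case z of (x, y) \<Rightarrow> d x y) < a} =
      {(x, y). x \<in> topspace X \<and> y \<in> topspace X \<and> d x y < a}"
    by (auto simp: space_pair)
  then show "{z \<in> space (\<mu> \<Otimes>\<^sub>M \<mu>). (case z of (x, y) \<Rightarrow> d x y) < a} \<in> sets (\<mu> \<Otimes>\<^sub>M \<mu>)"
    using openin_prod_in_sets_pair_measure[OF second_countable sets_\<mu> openin_distance_less] by simp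
qed

lemma sets_off_diagonal: "{(x, y). x \<in> topspace X \<and> y \<in> topspace X \<and> x \<noteq> y} \<in> sets (\<mu> \<Otimes>\<^sub>M \<mu>)"
proof (rule openin_prod_in_sets_pair_measure[OF second_countable sets_\<mu>])
  show "openin (prod_topology X X) {(x, y). x \<in> topspace X \<and> y \<in> topspace X \<and> x \<noteq> y}"
    unfolding openin_prod_topology_alt
  proof (intro allI impI)
    fix x y assume "(x, y) \<in> {(x, y). x \<in> topspace X \<and> y \<in> topspace X \<and> x \<noteq> y}"
    then have xy: "x \<in> topspace X \<and> y \<in> topspace X \<and> x \<noteq> y" by simp
    obtain U V where UV: "openin X U" "openin X V" "x \<in> U" "y \<in> V" "disjnt U V"
      using Hausdorff[unfolded Hausdorff_space_def, rule_format, OF xy] by blast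
    then have "U \<subseteq> topspace X" "V \<subseteq> topspace X" by (blast dest: openin_subset)+
    then have "U \<times> V \<subseteq> {(x, y). x \<in> topspace X \<and> y \<in> topspace X \<and> x \<noteq> y}"
      using UV(5) by (auto simp: disjnt_iff)
    then show "\<exists>U V. openin X U \<and> openin X V \<and> x \<in> U \<and> y \<in> V \<and>
        U \<times> V \<subseteq> {(x, y). x \<in> topspace X \<and> y \<in> topspace X \<and> x \<noteq> y}"
      using UV(1-4) by (intro exI[of _ U] exI[of _ V] conjI)
  qed
qed

lemma measurable_distance [measurable]:
  assumes "p \<in> topspace X"
  shows "d p \<in> borel_measurable \<mu>"
proof -
  have "(\<lambda>y. (p, y)) \<in> measurable \<mu> (\<mu> \<Otimes>\<^sub>M \<mu>)" using assms by (simp add: space_\<mu>)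
  from measurable_compose[OF this measurable_distance_pair] show ?thesis by simp
qed

lemma sphere_null:
  assumes p: "p \<in> topspace X" and t: "t \<ge> 0"
  shows "emeasure \<mu> {q \<in> space \<mu>. d p q = ennreal t} = 0"
proof (rule induced_measure_eq_0[OF induced])
  have "{q \<in> space \<mu>. d p q = ennreal t} \<in> sets \<mu>"
    using measurable_distance[OF p] by measurable
  then show "{q \<in> space \<mu>. d p q = ennreal t} \<in> borel_sets X" by (simp add: sets_\<mu>)
  fix c assume "c \<in> Ori"
  then have c: "c \<in> A" using oriented_charts by blast
  have "snd c ` (fst c \<inter> {q \<in> space \<mu>. d p q = ennreal t}) \<subseteq> {u \<in> snd c ` fst c. d p (chart_inv c u) = ennreal t}"
    using chart_inv_inverse(1)[OF c] by auto
  then show "negligible (snd c ` (fst c \<inter> {q \<in> space \<mu>. d p q = ennreal t}))"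
    by (rule negligible_subset[OF negligible_chart_sphere[OF c p t]])
qed

abbreviation samples :: "nat \<Rightarrow> (nat \<Rightarrow> 'a) measure" where
  "samples n \<equiv> Pi\<^sub>M {..<n} (\<lambda>_. \<mu>)"

lemma measurable_sample_pair:
  "i < n \<Longrightarrow> j < n \<Longrightarrow> (\<lambda>x. (x i, x j)) \<in> measurable (samples n) (\<mu> \<Otimes>\<^sub>M \<mu>)"
  by measurable

lemma sample_in_X: "x \<in> space (samples n) \<Longrightarrow> i < n \<Longrightarrow> x i \<in> topspace X"
  by (auto simp: space_PiM space_\<mu>)

lemma sets_sample_pair:
  assumes "i < n" "j < n" "W \<in> sets (\<mu> \<Otimes>\<^sub>M \<mu>)"
  shows "{x \<in> space (samples n). (x i, x j) \<in> W} \<in> sets (samples n)"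
  using measurable_sets[OF measurable_sample_pair[OF assms(1,2)] assms(3)]
  by (simp add: vimage_def Int_def conj_commute)

lemma measurable_sample_distance:
  "i < n \<Longrightarrow> j < n \<Longrightarrow> (\<lambda>x. d (x i) (x j)) \<in> borel_measurable (samples n)"
  using measurable_compose[OF measurable_sample_pair measurable_distance_pair] by simp

lemma sets_sample_eq:
  assumes "i < n" "j < n"
  shows "{x \<in> space (samples n). x i = x j} \<in> sets (samples n)"
proof -
  let ?D = "{x \<in> space (samples n). (x i, x j) \<in> {(x, y). x \<in> topspace X \<and> y \<in> topspace X \<and> x \<noteq> y}}"
  have "space (samples n) - ?D \<in> sets (samples n)" using sets_sample_pair[OF assms sets_off_diagonal] by blast
  moreover have "space (samples n) - ?D = {x \<in> space (samples n). x i = x j}" using sample_in_X assms by auto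
  ultimately show ?thesis by simp
qed

lemma measurable_invariant_sample:
  assumes "topological_invariant T"
  shows "(\<lambda>x. T (vietoris_rips d (x ` {..<n}) t)) \<in> borel_measurable (samples n)"
proof (rule borel_measurable_invariant_vietoris_rips[OF assms sets_sample_eq])
  fix i j assume ij: "i < n" "j < n"
  show "{x \<in> space (samples n). d (x i) (x j) \<le> ennreal t} \<in> sets (samples n)"
    using measurable_sample_distance[OF ij] by measurable
qed

lemma AE_distance_neq:
  assumes "t \<ge> 0"
  shows "AE x in (samples n). \<forall>i\<in>{..<n}. \<forall>j\<in>{..<n}. i \<noteq> j \<longrightarrow> d (x i) (x j) \<noteq> ennreal t"
proof (intro AE_finite_allI)
  fix i j assume "i \<in> {..<n}" "j \<in> {..<n}"
  then have ij: "i < n" "j < n" by auto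
  show "AE x in (samples n). i \<noteq> j \<longrightarrow> d (x i) (x j) \<noteq> ennreal t"
  proof (cases "i = j")
    case False
    let ?W = "{z \<in> space (\<mu> \<Otimes>\<^sub>M \<mu>). (case z of (x, y) \<Rightarrow> d x y) = ennreal t}"
    have W: "?W \<in> sets (\<mu> \<Otimes>\<^sub>M \<mu>)" by measurable
    have fib: "emeasure \<mu> (Pair x -` ?W) \<le> 0" if "x \<in> space \<mu>" for x
    proof -
      have "Pair x -` ?W = {q \<in> space \<mu>. d x q = ennreal t}"
        using that by (auto simp: space_pair space_\<mu>)
      then show ?thesis using sphere_null[of x t] that assms by (simp add: space_\<mu>)
    qed
    have "emeasure (samples n) {x \<in> space (samples n). (x i, x j) \<in> ?W} = 0"
      using emeasure_PiM_pair_le[OF prob_space_axioms ij False W fib] by simp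
    then have "AE x in (samples n). (x i, x j) \<notin> ?W"
      using sets_sample_pair[OF ij W] by (subst AE_iff_measurable[OF _ refl]) auto
    then show ?thesis
    proof (rule AE_mp, intro AE_I2 impI)
      fix x assume "x \<in> space (samples n)" "(x i, x j) \<notin> ?W"
      then show "d (x i) (x j) \<noteq> ennreal t"
        using sample_in_X[of x] ij by (simp add: space_pair)
    qed
  qed simp
qed auto

lemma prob_space_samples: "prob_space (samples n)"
  by (rule prob_space_PiM) (rule prob_space_axioms)

text \<open>
  Pairs with \<open>i = j\<close> never matter, as \<open>d p p = 0\<close> is within every nonnegative scale.
\<close>
lemma vietoris_rips_sample_cong:
  assumes x: "x \<in> space (samples n)" and "s \<ge> 0" "t \<ge> 0"
    and same: "\<And>i j. i < n \<Longrightarrow> j < n \<Longrightarrow> i \<noteq> j \<Longrightarrow> d (x i) (x j) \<le> ennreal s \<longleftrightarrow> d (x i) (x j) \<le> ennreal t"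
  shows "vietoris_rips d (x ` {..<n}) s = vietoris_rips d (x ` {..<n}) t"
proof (rule vietoris_rips_eqI)
  fix p q assume "p \<in> x ` {..<n}" "q \<in> x ` {..<n}"
  then obtain i j where ij: "i < n" "p = x i" "j < n" "q = x j" by auto
  show "d p q \<le> ennreal s \<longleftrightarrow> d p q \<le> ennreal t"
  proof (cases "i = j")
    case True
    then show ?thesis using distance_self[OF sample_in_X[OF x ij(1)]] ij by simp
  next
    case False
    then show ?thesis using same[OF ij(1,3)] ij by simp
  qed
qed

text \<open>
  The shell \<open>(s, t]\<close> is contained in the difference of the open balls of radii \<open>t\<close> and \<open>s\<close>, up to
  the sphere of radius \<open>t\<close>, which is null. The absolute value of \<open>K\<close> spares a case distinction on
  its sign.
\<close>
lemma measure_shell_le: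
  assumes p: "p \<in> topspace X" and st: "0 \<le> s" "s \<le> t"
    and K: "\<bar>measure \<mu> (riemannian_ball X A G t p) - measure \<mu> (riemannian_ball X A G s p)\<bar> \<le> K * \<bar>t - s\<bar>"
  shows "emeasure \<mu> {q \<in> space \<mu>. ennreal s < d p q \<and> d p q \<le> ennreal t} \<le> ennreal (\<bar>K\<bar> * (t - s))"
proof -
  note [measurable] = measurable_distance[OF p]
  have ball: "riemannian_ball X A G r p = {q \<in> space \<mu>. d p q < ennreal r}" for r
    by (simp add: riemannian_ball_def space_\<mu>)
  have sets: "{q \<in> space \<mu>. d p q < ennreal r} \<in> sets \<mu>" "{q \<in> space \<mu>. d p q = ennreal r} \<in> sets \<mu>" for r
    by measurable
  let ?B = "\<lambda>r. {q \<in> space \<mu>. d p q < ennreal r}"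
  have "?B s \<subseteq> ?B t" using st by (auto intro: order_less_le_trans ennreal_leI)
  then have diff: "measure \<mu> (?B t - ?B s) = measure \<mu> (?B t) - measure \<mu> (?B s)"
    using sets by (intro finite_measure_Diff) auto
  have "{q \<in> space \<mu>. ennreal s < d p q \<and> d p q \<le> ennreal t} \<subseteq> (?B t - ?B s) \<union> {q \<in> space \<mu>. d p q = ennreal t}"
    by (auto simp: le_less)
  then have "emeasure \<mu> {q \<in> space \<mu>. ennreal s < d p q \<and> d p q \<le> ennreal t} \<le>
      emeasure \<mu> ((?B t - ?B s) \<union> {q \<in> space \<mu>. d p q = ennreal t})"
    using sets by (intro emeasure_mono) auto
  also have "\<dots> = emeasure \<mu> (?B t - ?B s)"
    using sets sphere_null[OF p, of t] st by (intro emeasure_Un_null_set) (auto simp: null_sets_def)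
  also have "\<dots> = ennreal (measure \<mu> (?B t) - measure \<mu> (?B s))"
    by (simp add: emeasure_eq_measure diff)
  also have "\<dots> \<le> ennreal (\<bar>K\<bar> * (t - s))"
  proof (rule ennreal_leI)
    have "measure \<mu> (?B t) - measure \<mu> (?B s) \<le> K * \<bar>t - s\<bar>" using K by (simp add: ball)
    also have "\<dots> \<le> \<bar>K\<bar> * (t - s)" using st by (simp add: mult_right_mono)
    finally show "measure \<mu> (?B t) - measure \<mu> (?B s) \<le> \<bar>K\<bar> * (t - s)" .
  qed
  finally show ?thesis .
qed

lemma measure_sample_shell_le:
  assumes ij: "i < n" "j < n" "i \<noteq> j" and st: "0 \<le> s" "s \<le> t"
    and K: "\<And>p. p \<in> topspace X \<Longrightarrow>
      \<bar>measure \<mu> (riemannian_ball X A G t p) - measure \<mu> (riemannian_ball X A G s p)\<bar> \<le> K * \<bar>t - s\<bar>"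
  shows "{x \<in> space (samples n). ennreal s < d (x i) (x j) \<and> d (x i) (x j) \<le> ennreal t} \<in> sets (samples n)"
    and "measure (samples n) {x \<in> space (samples n). ennreal s < d (x i) (x j) \<and> d (x i) (x j) \<le> ennreal t} \<le> \<bar>K\<bar> * (t - s)"
proof -
  interpret S: prob_space "samples n" by (rule prob_space_samples)
  let ?D = "{x \<in> space (samples n). ennreal s < d (x i) (x j) \<and> d (x i) (x j) \<le> ennreal t}"
  let ?W = "{z \<in> space (\<mu> \<Otimes>\<^sub>M \<mu>). ennreal s < (case z of (x, y) \<Rightarrow> d x y) \<and> (case z of (x, y) \<Rightarrow> d x y) \<le> ennreal t}"
  have W: "?W \<in> sets (\<mu> \<Otimes>\<^sub>M \<mu>)" by measurable
  have D: "{x \<in> space (samples n). (x i, x j) \<in> ?W} = ?D"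
    using sample_in_X ij(1,2) by (auto simp: space_pair)
  show "?D \<in> sets (samples n)" using sets_sample_pair[OF ij(1,2) W] by (simp only: D)
  have fib: "emeasure \<mu> (Pair p -` ?W) \<le> ennreal (\<bar>K\<bar> * (t - s))" if "p \<in> space \<mu>" for p
  proof -
    have "Pair p -` ?W = {q \<in> space \<mu>. ennreal s < d p q \<and> d p q \<le> ennreal t}"
      using that by (auto simp: space_pair space_\<mu>)
    then show ?thesis using measure_shell_le[OF _ st K, of p] that by (simp add: space_\<mu>)
  qed
  have "emeasure (samples n) ?D \<le> ennreal (\<bar>K\<bar> * (t - s))"
    using emeasure_PiM_pair_le[OF prob_space_axioms ij W fib] by (simp only: D)
  then show "measure (samples n) ?D \<le> \<bar>K\<bar> * (t - s)"
    using st by (simp add: S.emeasure_eq_measure)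
qed

section \<open>Expectations of topological invariants\<close>

context
  fixes T :: "'a set set \<Rightarrow> real" and f :: "nat \<Rightarrow> real" and n :: nat
  assumes T: "topological_invariant T"
    and bound: "\<And>S. finite_simplicial_complex S \<Longrightarrow> \<bar>T S\<bar> \<le> f (card S)"
begin

abbreviation "TX t x \<equiv> T (vietoris_rips d (x ` {..<n}) t)"

text \<open>
  A sum in place of a maximum of the values of \<open>f\<close>, which need not be monotone.
\<close>
abbreviation "F \<equiv> (\<Sum>k\<le>2 ^ n. \<bar>f k\<bar>)"

lemma invariant_sample_bound: "\<bar>TX t x\<bar> \<le> F"
proof -
  have "card (vietoris_rips d (x ` {..<n}) t) \<le> 2 ^ card (x ` {..<n})"
    by (rule finite_simplicial_complex_vietoris_rips) simp
  also have "\<dots> \<le> 2 ^ n"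
    using card_image_le[of "{..<n}" x] by (intro power_increasing) auto
  finally have card: "card (vietoris_rips d (x ` {..<n}) t) \<in> {..2 ^ n}" by simp
  have "\<bar>TX t x\<bar> \<le> \<bar>f (card (vietoris_rips d (x ` {..<n}) t))\<bar>"
    using bound[OF finite_simplicial_complex_vietoris_rips(1)[of "x ` {..<n}" d t]] by simp
  also have "\<dots> \<le> F"
    using card by (intro member_le_sum[of _ _ "\<lambda>k. \<bar>f k\<bar>"]) auto
  finally show ?thesis .
qed

lemma integrable_invariant_sample: "integrable (samples n) (TX t)"
proof -
  interpret S: prob_space "samples n" by (rule prob_space_samples)
  show ?thesis
    using measurable_invariant_sample[OF T] invariant_sample_bound
    by (intro S.integrable_const_bound[of _ F]) auto
qed

text \<open>
  If no distance of the sample equals \<open>a\<close>, then each of the finitely many comparisons with the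
  scale is eventually constant, and so is the complex.
\<close>
lemma tendsto_invariant_sample:
  assumes x: "x \<in> space (samples n)" and a: "a \<ge> 0" and u: "\<And>k. u k \<ge> 0" "u \<longlonglongrightarrow> a"
    and neq: "\<forall>i\<in>{..<n}. \<forall>j\<in>{..<n}. i \<noteq> j \<longrightarrow> d (x i) (x j) \<noteq> ennreal a"
  shows "(\<lambda>k. TX (u k) x) \<longlonglongrightarrow> TX a x"
proof -
  have "\<forall>\<^sub>F k in sequentially. i \<noteq> j \<longrightarrow> (d (x i) (x j) \<le> ennreal (u k) \<longleftrightarrow> d (x i) (x j) \<le> ennreal a)"
    if "i \<in> {..<n}" "j \<in> {..<n}" for i j
  proof (cases "i = j")
    case False
    have u': "(\<lambda>k. ennreal (u k)) \<longlonglongrightarrow> ennreal a" using u(2) by (rule tendsto_ennrealI)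
    have "d (x i) (x j) \<noteq> ennreal a" using neq that False by blast
    then consider "d (x i) (x j) < ennreal a" | "ennreal a < d (x i) (x j)" by (rule linorder_neqE)
    then show ?thesis
    proof cases
      case 1
      from order_tendstoD(1)[OF u' 1] show ?thesis
        by eventually_elim (use 1 in auto)
    next
      case 2
      from order_tendstoD(2)[OF u' 2] show ?thesis
        by eventually_elim (use 2 in auto)
    qed
  qed simp
  then have "\<forall>\<^sub>F k in sequentially. \<forall>i\<in>{..<n}. \<forall>j\<in>{..<n}.
      i \<noteq> j \<longrightarrow> (d (x i) (x j) \<le> ennreal (u k) \<longleftrightarrow> d (x i) (x j) \<le> ennreal a)"
    by (intro eventually_ball_finite ballI) auto
  then have "\<forall>\<^sub>F k in sequentially. TX (u k) x = TX a x"
  proof eventually_elim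
    case (elim k)
    have "vietoris_rips d (x ` {..<n}) (u k) = vietoris_rips d (x ` {..<n}) a"
      by (rule vietoris_rips_sample_cong[OF x u(1) a]) (use elim in blast)
    then show ?case by simp
  qed
  then show ?thesis by (rule tendsto_eventually)
qed

lemma continuous_on_expectation: "continuous_on {0..} (\<lambda>t. integral\<^sup>L (samples n) (TX t))"
proof (rule continuous_on_sequentiallyI)
  interpret S: prob_space "samples n" by (rule prob_space_samples)
  fix u :: "nat \<Rightarrow> real" and a assume u: "\<forall>k. u k \<in> {0..}" "a \<in> {0..}" "u \<longlonglongrightarrow> a"
  have a: "a \<ge> 0" and u0: "\<And>k. u k \<ge> 0" using u by auto
  show "(\<lambda>k. integral\<^sup>L (samples n) (TX (u k))) \<longlonglongrightarrow> integral\<^sup>L (samples n) (TX a)"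
  proof (rule integral_dominated_convergence[where w = "\<lambda>_. F"])
    show "AE x in samples n. (\<lambda>k. TX (u k) x) \<longlonglongrightarrow> TX a x"
      using AE_distance_neq[OF a, of n] AE_space
      by eventually_elim (rule tendsto_invariant_sample[OF _ a u0 u(3)])
    show "AE x in samples n. norm (TX (u k) x) \<le> F" for k
      using invariant_sample_bound by simp
  qed (use measurable_invariant_sample[OF T] in auto)
qed

text \<open>
  The invariant changes by at most \<open>2 * F\<close>, and only on samples for which one of at most \<open>n\<^sup>2\<close> pairs has
  its distance in the shell.
\<close>
lemma expectation_increment_le:
  assumes st: "0 \<le> s" "s \<le> t"
    and K: "\<And>p. p \<in> topspace X \<Longrightarrow>
      \<bar>measure \<mu> (riemannian_ball X A G t p) - measure \<mu> (riemannian_ball X A G s p)\<bar> \<le> K * \<bar>t - s\<bar>"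
  shows "\<bar>integral\<^sup>L (samples n) (TX t) - integral\<^sup>L (samples n) (TX s)\<bar> \<le> 2 * F * real (n * n) * \<bar>K\<bar> * (t - s)"
proof -
  interpret S: prob_space "samples n" by (rule prob_space_samples)
  let ?D = "\<lambda>(i, j). {x \<in> space (samples n). ennreal s < d (x i) (x j) \<and> d (x i) (x j) \<le> ennreal t}"
  define P where "P = {(i, j). i < n \<and> j < n \<and> i \<noteq> j}"
  have P: "P \<subseteq> {..<n} \<times> {..<n}" "finite P"
    by (auto simp: P_def intro: finite_subset[of _ "{..<n} \<times> {..<n}"])
  have "card P \<le> n * n" using card_mono[OF _ P(1)] by (simp add: card_cartesian_product)
  have D: "?D ij \<in> sets (samples n)" "measure (samples n) (?D ij) \<le> \<bar>K\<bar> * (t - s)" if "ij \<in> P" for ij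
    using measure_sample_shell_le[OF _ _ _ st K] that by (auto simp: P_def)
  have F: "0 \<le> F" by (simp add: sum_nonneg)
  have pointwise: "\<bar>TX t x - TX s x\<bar> \<le> (\<Sum>ij\<in>P. 2 * F * indicator (?D ij) x)" if x: "x \<in> space (samples n)" for x
  proof (cases "\<exists>ij\<in>P. x \<in> ?D ij")
    case True
    then obtain ij where ij: "ij \<in> P" "x \<in> ?D ij" by blast
    have "\<bar>TX t x - TX s x\<bar> \<le> 2 * F"
      using invariant_sample_bound[of x t] invariant_sample_bound[of x s] by linarith
    also have "2 * F = 2 * F * indicator (?D ij) x" using ij(2) by simp
    also have "\<dots> \<le> (\<Sum>ij\<in>P. 2 * F * indicator (?D ij) x)"
      using ij(1) P(2) F by (intro member_le_sum) auto
    finally show ?thesis .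
  next
    case False
    have "vietoris_rips d (x ` {..<n}) t = vietoris_rips d (x ` {..<n}) s"
    proof (rule vietoris_rips_sample_cong[OF x])
      show "0 \<le> t" "0 \<le> s" using st by auto
      fix i j assume ij: "i < n" "j < n" "i \<noteq> j"
      then have "x \<notin> ?D (i, j)" using False by (auto simp: P_def)
      then have "\<not> (ennreal s < d (x i) (x j) \<and> d (x i) (x j) \<le> ennreal t)" using x by simp
      moreover have "ennreal s \<le> ennreal t" using st by (intro ennreal_leI)
      ultimately show "d (x i) (x j) \<le> ennreal t \<longleftrightarrow> d (x i) (x j) \<le> ennreal s"
        by (meson not_le order_trans)
    qed
    then have "\<bar>TX t x - TX s x\<bar> = 0" by simp
    also have "\<dots> \<le> (\<Sum>ij\<in>P. 2 * F * indicator (?D ij) x)"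
      using F by (intro sum_nonneg mult_nonneg_nonneg) auto
    finally show ?thesis .
  qed
  have int_D: "integrable (samples n) (\<lambda>x. 2 * F * indicator (?D ij) x)" if "ij \<in> P" for ij
    using D(1)[OF that] by (intro integrable_mult_right) (simp add: S.emeasure_eq_measure)
  have "\<bar>integral\<^sup>L (samples n) (TX t) - integral\<^sup>L (samples n) (TX s)\<bar> =
      \<bar>integral\<^sup>L (samples n) (\<lambda>x. TX t x - TX s x)\<bar>"
    by (subst Bochner_Integration.integral_diff) (auto intro: integrable_invariant_sample)
  also have "\<dots> \<le> integral\<^sup>L (samples n) (\<lambda>x. \<bar>TX t x - TX s x\<bar>)"
    by (rule integral_abs_bound)
  also have "\<dots> \<le> integral\<^sup>L (samples n) (\<lambda>x. \<Sum>ij\<in>P. 2 * F * indicator (?D ij) x)"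
    by (rule integral_mono[OF _ _ pointwise])
      (intro integrable_abs Bochner_Integration.integrable_diff integrable_invariant_sample
        Bochner_Integration.integrable_sum int_D)+
  also have "\<dots> = (\<Sum>ij\<in>P. integral\<^sup>L (samples n) (\<lambda>x. 2 * F * indicator (?D ij) x))"
    by (rule Bochner_Integration.integral_sum) (rule int_D)
  also have "\<dots> = (\<Sum>ij\<in>P. 2 * F * measure (samples n) (?D ij))"
    using D(1) by (intro sum.cong refl) (simp add: Int_absorb2 sets.sets_into_space)
  also have "\<dots> \<le> (\<Sum>ij\<in>P. 2 * F * (\<bar>K\<bar> * (t - s)))"
    using D(2) F by (intro sum_mono mult_left_mono) auto
  also have "\<dots> = real (card P) * (2 * F * (\<bar>K\<bar> * (t - s)))" by simp
  also have "\<dots> \<le> real (n * n) * (2 * F * (\<bar>K\<bar> * (t - s)))"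
    using \<open>card P \<le> n * n\<close> F st by (intro mult_right_mono) (auto simp del: of_nat_mult)
  finally show ?thesis by (simp only: ac_simps)
qed

lemma lipschitz_on_expectation:
  assumes K: "\<And>p a b. p \<in> topspace X \<Longrightarrow>
      \<bar>measure \<mu> (riemannian_ball X A G b p) - measure \<mu> (riemannian_ball X A G a p)\<bar> \<le> K * \<bar>b - a\<bar>"
  shows "(2 * F * real (n * n) * \<bar>K\<bar>)-lipschitz_on {0..} (\<lambda>t. integral\<^sup>L (samples n) (TX t))"
proof (rule lipschitz_onI)
  let ?L = "2 * F * real (n * n) * \<bar>K\<bar>"
  show "0 \<le> ?L" by (intro mult_nonneg_nonneg sum_nonneg) auto
  fix s t :: real assume st: "s \<in> {0..}" "t \<in> {0..}"
  show "dist (integral\<^sup>L (samples n) (TX s)) (integral\<^sup>L (samples n) (TX t)) \<le> ?L * dist s t"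
  proof (cases "s \<le> t")
    case True
    then show ?thesis using expectation_increment_le[OF _ True K] st by (simp add: dist_real_def abs_minus_commute)
  next
    case False
    then show ?thesis using expectation_increment_le[OF _ _ K, of t s] False st by (simp add: dist_real_def abs_minus_commute)
  qed
qed

end
end

theorem theorem1p1:
  fixes X :: "'a topology"
    and A Ori :: "('a, 'n::finite) chart set"
    and G :: "('a, 'n) metric_tensor"
    and w :: "('a, 'n) top_form"
    and \<mu> :: "'a measure"
    and T :: "'a set set \<Rightarrow> real"
    and f :: "nat \<Rightarrow> real"
    and n :: nat
  defines "d \<equiv> riemannian_distance X A G"
  defines "TX \<equiv> (\<lambda>t (x :: nat \<Rightarrow> 'a). T (vietoris_rips d (x ` {..<n}) t))"
  defines "\<mu>n \<equiv> Pi\<^sub>M {..<n} (\<lambda>_. \<mu>)"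
  assumes "smooth_manifold X A" and "orientation X A Ori"
    and "riemannian_metric A G" and "riemannian_complete X A G"
    and "continuous_top_form A w" and "semi_positive Ori w"
    and "induced_measure X Ori w \<mu>" and "prob_space \<mu>"
    and "topological_invariant T"
    and "\<And>S. finite_simplicial_complex S \<Longrightarrow> \<bar>T S\<bar> \<le> f (card S)"
    and "n \<ge> 1"
  shows "(\<forall>t\<ge>0. integrable \<mu>n (TX t)) \<and>
    continuous_on {0..} (\<lambda>t. integral\<^sup>L \<mu>n (TX t)) \<and>
    ((\<exists>K::real. \<forall>p\<in>topspace X. \<forall>a b.
        \<bar>measure \<mu> (riemannian_ball X A G b p) - measure \<mu> (riemannian_ball X A G a p)\<bar>
          \<le> K * \<bar>b - a\<bar>) \<longrightarrow>
      (\<exists>L. L-lipschitz_on {0..} (\<lambda>t. integral\<^sup>L \<mu>n (TX t))))"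
proof -
  interpret induced_probability X A G \<mu> Ori w
    by (intro induced_probability.intro riemannian_structure.intro induced_probability_axioms.intro)
      (use assms in \<open>simp_all add: orientation_def\<close>)
  show ?thesis
    unfolding TX_def d_def \<mu>n_def
  proof (intro conjI allI impI)
    note T = \<open>topological_invariant T\<close> assms(13)
    show "integrable (samples n) (\<lambda>x. T (vietoris_rips (riemannian_distance X A G) (x ` {..<n}) t))" for t
      by (rule integrable_invariant_sample[OF T])
    show "continuous_on {0..} (\<lambda>t. integral\<^sup>L (samples n)
        (\<lambda>x. T (vietoris_rips (riemannian_distance X A G) (x ` {..<n}) t)))"
      by (rule continuous_on_expectation[OF T])
    assume "\<exists>K::real. \<forall>p\<in>topspace X. \<forall>a b.
        \<bar>measure \<mu> (riemannian_ball X A G b p) - measure \<mu> (riemannian_ball X A G a p)\<bar> \<le> K * \<bar>b - a\<bar>"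
    then obtain K where "\<And>p a b. p \<in> topspace X \<Longrightarrow>
        \<bar>measure \<mu> (riemannian_ball X A G b p) - measure \<mu> (riemannian_ball X A G a p)\<bar> \<le> K * \<bar>b - a\<bar>"
      by blast
    from lipschitz_on_expectation[OF T this]
    show "\<exists>L. L-lipschitz_on {0..} (\<lambda>t. integral\<^sup>L (samples n)
        (\<lambda>x. T (vietoris_rips (riemannian_distance X A G) (x ` {..<n}) t)))" by blast
  qed
qed

end
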